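(* There is an algorithm that, given a $\beta$-acyclic hypergraph $\mathcal{H}$, computes the number of minimal transversals of $\mathcal{H}$ in time polynomial in the size of $\mathcal{H}$.
   Context: A hypergraph $\mathcal{H}$ is a finite collection of subsets (hyperedges) of a finite ground set; $V(\mathcal{H})=\bigcup_{e\in\mathcal{H}} e$. A transversal of $\mathcal{H}$ is a set $T\subseteq V(\mathcal{H})$ with $T\cap e\neq\emptyset$ for every $e\in\mathcal{H}$; it is minimal if no proper subset is a transversal. $\mathcal{H}$ is $\beta$-acyclic if there is an ordering $x_1,\ldots,x_n$ of $V(\mathcal{H})$ such that for each $i$ the set $\{e\cap\{x_i,\ldots,x_n\}\mid e\in\mathcal{H}, x_i\in e\}$ is totally ordered by inclusion. *)

theory Defs
  imports "HOL-Computational_Algebra.Polynomial"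
begin

section \<open>Hypergraphs\<close>

text \<open>Edges may be empty, and so may the hypergraph itself.\<close>

definition hypergraph :: "'a set set \<Rightarrow> bool" where
  "hypergraph H \<longleftrightarrow> finite H \<and> (\<forall>e\<in>H. finite e)"

definition vertices :: "'a set set \<Rightarrow> 'a set" where
  "vertices H = \<Union>H"

definition transversal :: "'a set set \<Rightarrow> 'a set \<Rightarrow> bool" where
  "transversal H T \<longleftrightarrow> T \<subseteq> vertices H \<and> (\<forall>e\<in>H. T \<inter> e \<noteq> {})"

definition minimal_transversal :: "'a set set \<Rightarrow> 'a set \<Rightarrow> bool" where
  "minimal_transversal H T \<longleftrightarrow> transversal H T \<and> (\<forall>T'. T' \<subset> T \<longrightarrow> \<not> transversal H T')"

text \<open>Positions in the ordering \<open>xs\<close> are counted from 0, so \<open>set (drop i xs)\<close> consists of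
  the \<open>i\<close>-th vertex and all later ones.\<close>

definition beta_elimination_order :: "'a set set \<Rightarrow> 'a list \<Rightarrow> bool" where
  "beta_elimination_order H xs \<longleftrightarrow>
     distinct xs \<and> set xs = vertices H \<and>
     (\<forall>i<length xs. chain\<^sub>\<subseteq> {e \<inter> set (drop i xs) | e. e \<in> H \<and> xs ! i \<in> e})"

definition beta_acyclic :: "'a set set \<Rightarrow> bool" where
  "beta_acyclic H \<longleftrightarrow> (\<exists>xs. beta_elimination_order H xs)"


section \<open>The model of computation\<close>

text \<open>The machine model is the language WHILE of N. D. Jones (Computability and Complexity from a
  Programming Perspective, MIT Press 1997): imperative programs whose variables hold binary trees
  built from a single atom, with unit cost for every elementary operation. There is no built-in
  arithmetic and no equality test on trees. Since trees can be shared, an operation costs constant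
  time and allocates at most one cell; polynomial time in this model is polynomial time on Turing
  machines.\<close>

datatype tree = Atom | Pair tree tree

fun left :: "tree \<Rightarrow> tree" where
  "left Atom = Atom"
| "left (Pair l r) = l"

fun right :: "tree \<Rightarrow> tree" where
  "right Atom = Atom"
| "right (Pair l r) = r"

type_synonym state = "nat \<Rightarrow> tree"

datatype exp = Var nat | Nil | Cons exp exp | Hd exp | Tl exp

fun exp_val :: "exp \<Rightarrow> state \<Rightarrow> tree" where
  "exp_val (Var x) s = s x"
| "exp_val Nil s = Atom"
| "exp_val (Cons a b) s = Pair (exp_val a s) (exp_val b s)"
| "exp_val (Hd a) s = left (exp_val a s)"
| "exp_val (Tl a) s = right (exp_val a s)"

fun exp_cost :: "exp \<Rightarrow> nat" where
  "exp_cost (Var x) = 1"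
| "exp_cost Nil = 1"
| "exp_cost (Cons a b) = 1 + exp_cost a + exp_cost b"
| "exp_cost (Hd a) = 1 + exp_cost a"
| "exp_cost (Tl a) = 1 + exp_cost a"

datatype com = Skip | Assign nat exp | Seq com com | If exp com com | While exp com

text \<open>\<open>exec c s t s'\<close>: started in state \<open>s\<close>, the program \<open>c\<close> terminates after exactly \<open>t\<close> steps in
  state \<open>s'\<close>. A test succeeds iff its value is not the atom.\<close>

inductive exec :: "com \<Rightarrow> state \<Rightarrow> nat \<Rightarrow> state \<Rightarrow> bool" where
  exec_Skip: "exec Skip s 1 s"
| exec_Assign: "exec (Assign x a) s (1 + exp_cost a) (s(x := exp_val a s))"
| exec_Seq: "exec c1 s t1 s1 \<Longrightarrow> exec c2 s1 t2 s2 \<Longrightarrow> exec (Seq c1 c2) s (1 + t1 + t2) s2"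
| exec_IfTrue: "exp_val a s \<noteq> Atom \<Longrightarrow> exec c1 s t s' \<Longrightarrow>
    exec (If a c1 c2) s (1 + exp_cost a + t) s'"
| exec_IfFalse: "exp_val a s = Atom \<Longrightarrow> exec c2 s t s' \<Longrightarrow>
    exec (If a c1 c2) s (1 + exp_cost a + t) s'"
| exec_WhileFalse: "exp_val a s = Atom \<Longrightarrow> exec (While a c) s (1 + exp_cost a) s"
| exec_WhileTrue: "exp_val a s \<noteq> Atom \<Longrightarrow> exec c s t1 s1 \<Longrightarrow> exec (While a c) s1 t2 s2 \<Longrightarrow>
    exec (While a c) s (1 + exp_cost a + t1 + t2) s2"

inductive_cases exec_SkipE: "exec Skip s t s'"
inductive_cases exec_AssignE: "exec (Assign x a) s t s'"
inductive_cases exec_SeqE: "exec (Seq c1 c2) s t s'"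
inductive_cases exec_IfE: "exec (If a c1 c2) s t s'"
inductive_cases exec_WhileE: "exec (While a c) s t s'"

lemma exec_deterministic:
  "exec c s t s' \<Longrightarrow> exec c s u s'' \<Longrightarrow> t = u \<and> s' = s''"
proof (induction arbitrary: u s'' rule: exec.induct)
  case (exec_Skip s)
  then show ?case by (elim exec_SkipE) simp
next
  case (exec_Assign x a s)
  then show ?case by (elim exec_AssignE) simp
next
  case (exec_Seq c1 s t1 s1 c2 t2 s2)
  from exec_Seq.prems obtain u1 v u2
    where u: "u = 1 + u1 + u2" "exec c1 s u1 v" "exec c2 v u2 s''"
    by (elim exec_SeqE) simp
  from exec_Seq.IH(1)[OF u(2)] exec_Seq.IH(2) u show ?case by simp
next
  case (exec_IfTrue a s c1 t s' c2)
  from exec_IfTrue.prems exec_IfTrue.hyps(1) obtain u1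
    where u: "u = 1 + exp_cost a + u1" "exec c1 s u1 s''"
    by (elim exec_IfE) simp_all
  from exec_IfTrue.IH[OF u(2)] u(1) show ?case by simp
next
  case (exec_IfFalse a s c2 t s' c1)
  from exec_IfFalse.prems exec_IfFalse.hyps(1) obtain u1
    where u: "u = 1 + exp_cost a + u1" "exec c2 s u1 s''"
    by (elim exec_IfE) simp_all
  from exec_IfFalse.IH[OF u(2)] u(1) show ?case by simp
next
  case (exec_WhileFalse a s c)
  from exec_WhileFalse.prems exec_WhileFalse.hyps(1) show ?case
    by - (erule exec_WhileE, simp_all)
next
  case (exec_WhileTrue a s c t1 s1 t2 s2)
  from exec_WhileTrue.prems exec_WhileTrue.hyps(1) obtain u1 v u2
    where u: "u = 1 + exp_cost a + u1 + u2" "exec c s u1 v" "exec (While a c) v u2 s''"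
    by - (erule exec_WhileE, simp_all)
  from exec_WhileTrue.IH(1)[OF u(2)] have v: "t1 = u1" "s1 = v" by simp_all
  from exec_WhileTrue.IH(2)[of u2 s''] u(3) v(2) have "t2 = u2" "s2 = s''" by simp_all
  with v u(1) show ?case by simp
qed

text \<open>Input and output are passed in variable 0; all other variables are initially the atom.\<close>

definition initial_state :: "tree \<Rightarrow> state" where
  "initial_state d = (\<lambda>x. if x = 0 then d else Atom)"

definition runs_to :: "com \<Rightarrow> tree \<Rightarrow> nat \<Rightarrow> tree \<Rightarrow> bool" where
  "runs_to c d t r \<longleftrightarrow> (\<exists>s. exec c (initial_state d) t s \<and> s 0 = r)"


section \<open>Encoding of inputs and outputs\<close>

fun encode_list :: "('a \<Rightarrow> tree) \<Rightarrow> 'a list \<Rightarrow> tree" where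
  "encode_list f [] = Atom"
| "encode_list f (x # xs) = Pair (f x) (encode_list f xs)"

fun encode_bool :: "bool \<Rightarrow> tree" where
  "encode_bool False = Atom"
| "encode_bool True = Pair Atom Atom"

text \<open>Binary representation, least significant bit first, without leading zeros.\<close>

fun nat_bits :: "nat \<Rightarrow> bool list" where
  "nat_bits n = (if n = 0 then [] else odd n # nat_bits (n div 2))"

declare nat_bits.simps [simp del]

definition encode_nat :: "nat \<Rightarrow> tree" where
  "encode_nat n = encode_list encode_bool (nat_bits n)"

text \<open>A hypergraph whose vertices are (named by) natural numbers is given to a program as a list of
  its edges, each a list of its vertices, in arbitrary order and without repetitions.\<close>

definition lists_hypergraph :: "nat list list \<Rightarrow> nat set set \<Rightarrow> bool" where
  "lists_hypergraph ess H \<longleftrightarrow>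
     distinct (map set ess) \<and> (\<forall>es\<in>set ess. distinct es) \<and> set (map set ess) = H"

definition encode_hypergraph :: "nat list list \<Rightarrow> tree" where
  "encode_hypergraph ess = encode_list (encode_list encode_nat) ess"

text \<open>The number of vertex occurrences and edges, plus the total length of the vertex names. The
  number of nodes of an encoding of \<open>H\<close> is linear in this size.\<close>

definition hypergraph_size :: "nat set set \<Rightarrow> nat" where
  "hypergraph_size H = (\<Sum>e\<in>H. 1 + (\<Sum>v\<in>e. 1 + length (nat_bits v)))"

end

theory Submission
  imports Defs
begin

text \<open>
  By inclusion-exclusion, the number of minimal transversals is the sum of \<open>(-1) ^ card {v. w v = 1}\<close>
  over all \<open>w : V \<rightarrow> {0, 1, 2}\<close> that give every edge total weight at least 2: weights 1 and 2
  select a vertex, and weight 1 forbids it to be the only selected vertex of an edge.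
  A vertex in no edge contributes the factor \<open>1 - 1 + 1 = 1\<close>, so this signed sum is multiplicative
  over vertex-disjoint sets of edges.

  Let \<open>vs\<close> be an initial segment of an elimination order and let the edges be sorted
  lexicographically, the last vertex of the order being most significant. Walks through vertices of
  \<open>vs\<close> along increasing edges define for each edge \<open>e\<close> a component of edges below \<open>e\<close>; these
  components are laminar, and outside \<open>vs\<close> their edges are contained in \<open>e\<close>. Once the weights outside
  \<open>vs\<close> are fixed, edges of weight at least 2 drop out, and what is left is a disjoint union of
  components. Within the component of \<open>e\<close>, the only relevant information on those weights is which
  vertex of \<open>e\<close>, if any, has weight 1. This leaves polynomially many table entries,
  and branching on the weight of the last vertex of \<open>vs\<close> computes each of them from
  products of entries for a shorter \<open>vs\<close>. Signs are dealt with by computing modulo a power of 2 that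
  exceeds the result.
\<close>

section \<open>Polynomial time functions between encodable types\<close>

text \<open>Overloading gives every type built from booleans, naturals, lists and pairs its
  canonical tree, so that running times can be stated for functions on these types. On lists of
  lists of naturals \<open>enc\<close> agrees with \<open>encode_hypergraph\<close>.\<close>

class encodable =
  fixes enc :: "'a \<Rightarrow> tree"

instantiation bool :: encodable
begin
definition enc_bool_def: "enc = encode_bool"
instance ..
end

instantiation nat :: encodable
begin
definition enc_nat_def: "enc = encode_nat"
instance ..
end

instantiation list :: (encodable) encodable
begin
definition enc_list_def: "enc = encode_list enc"
instance ..
end

instantiation prod :: (encodable, encodable) encodable
begin
definition enc_prod_def: "enc p = Pair (enc (fst p)) (enc (snd p))"
instance ..
end

lemma enc_bool_simps [simp]: "enc False = Atom" "enc True = Pair Atom Atom"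
  by (simp_all add: enc_bool_def)

lemma enc_list_simps [simp]: "enc [] = Atom" "enc (x # xs) = Pair (enc x) (enc xs)"
  by (simp_all add: enc_list_def)

lemma enc_Pair [simp]: "enc (a, b) = Pair (enc a) (enc b)"
  by (simp add: enc_prod_def)

lemma enc_eq_Atom_bool [simp]: "enc b = Atom \<longleftrightarrow> \<not> b"
  by (cases b) auto

lemma enc_eq_Atom_list [simp]: "enc xs = Atom \<longleftrightarrow> xs = []"
  by (cases xs) auto

text \<open>\<open>size\<close> counts the \<open>Pair\<close> cells of a tree. The atom has size 0,
  so a list element costs one cell beyond its own encoding.\<close>

abbreviation esize :: "'a::encodable \<Rightarrow> nat" where
  "esize x \<equiv> size (enc x)"

lemma esize_bool: "esize (b::bool) \<le> 1"
  by (cases b) auto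

lemma esize_list: "esize xs = (\<Sum>x\<leftarrow>xs. Suc (esize x))"
  by (induction xs) auto

lemma length_le_esize: "length xs \<le> esize xs"
  by (induction xs) auto

lemma esize_le_of_mem: "x \<in> set xs \<Longrightarrow> esize x \<le> esize xs"
  by (induction xs) auto

lemma esize_append: "esize (xs @ ys) = esize xs + esize ys"
  by (induction xs) auto

lemma esize_filter: "esize (filter P xs) \<le> esize xs"
  by (induction xs) auto

lemma esize_list_le: "(\<And>x. x \<in> set xs \<Longrightarrow> esize x \<le> B) \<Longrightarrow> esize xs \<le> length xs * Suc B"
proof (induction xs)
  case (Cons x xs)
  from Cons.prems[of x] Cons.IH[OF Cons.prems] show ?case by simp
qed simp

subsection \<open>Polynomially bounded functions\<close>

definition pbound :: "('x::encodable \<Rightarrow> nat) \<Rightarrow> bool" where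
  "pbound g \<longleftrightarrow> (\<exists>q :: nat poly. \<forall>x. g x \<le> poly q (esize x))"

lemma poly_nat_mono: "a \<le> b \<Longrightarrow> poly (q :: nat poly) a \<le> poly q b"
  by (induction q) (auto intro!: mult_mono)

lemma pbound_const: "pbound (\<lambda>x. c)"
  unfolding pbound_def by (rule exI[of _ "[:c:]"]) simp

lemma pbound_esize: "pbound esize"
  unfolding pbound_def by (rule exI[of _ "[:0, 1:]"]) simp

lemma pbound_add: "pbound f \<Longrightarrow> pbound g \<Longrightarrow> pbound (\<lambda>x. f x + g x)"
  unfolding pbound_def by (metis add_mono poly_add)

lemma pbound_mult: "pbound f \<Longrightarrow> pbound g \<Longrightarrow> pbound (\<lambda>x. f x * g x)"
  unfolding pbound_def by (metis mult_le_mono poly_mult)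

lemma pbound_Suc: "pbound f \<Longrightarrow> pbound (\<lambda>x. Suc (f x))"
  using pbound_add[OF pbound_const[of 1]] by simp

lemma pbound_mono: "pbound g \<Longrightarrow> (\<And>x. f x \<le> g x) \<Longrightarrow> pbound f"
  unfolding pbound_def by (meson le_trans)

lemma pbound_compose:
  assumes "pbound g" "pbound (\<lambda>x. esize (f x))"
  shows "pbound (\<lambda>x. g (f x))"
proof -
  from assms obtain q r :: "nat poly"
    where q: "\<And>y. g y \<le> poly q (esize y)" and r: "\<And>x. esize (f x) \<le> poly r (esize x)"
    unfolding pbound_def by blast
  have "g (f x) \<le> poly (pcompose q r) (esize x)" for x
    using q[of "f x"] poly_nat_mono[OF r[of x], of q] by (simp add: poly_pcompose)
  then show ?thesis unfolding pbound_def by blast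
qed

subsection \<open>Programs as functions on variable 0, with a stack in variable 1\<close>

text \<open>The start state is arbitrary apart from variable 0, and variable 1 comes back unchanged.
  Data that must survive a subprogram can therefore be pushed onto variable 1, and programs can be
  nested without renaming variables.\<close>

definition runs :: "com \<Rightarrow> ('a::encodable \<Rightarrow> 'b::encodable) \<Rightarrow> ('a \<Rightarrow> nat) \<Rightarrow> bool" where
  "runs P f T \<longleftrightarrow> (\<forall>s x. s 0 = enc x \<longrightarrow>
     (\<exists>t s'. exec P s t s' \<and> s' 0 = enc (f x) \<and> s' 1 = s 1 \<and> t \<le> T x))"

text \<open>The bound on the output is a separate demand: through sharing, a short run can build a
  tree of exponential size, and then a composition need not be polynomial.\<close>

definition polytime :: "('a::encodable \<Rightarrow> 'b::encodable) \<Rightarrow> bool" where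
  "polytime f \<longleftrightarrow> pbound (\<lambda>x. esize (f x)) \<and> (\<exists>P T. pbound T \<and> runs P f T)"

named_theorems polytime_intros

lemma polytime_pbound: "polytime f \<Longrightarrow> pbound (\<lambda>x. esize (f x))"
  by (simp add: polytime_def)

lemma polytimeE:
  assumes "polytime f"
  obtains P T where "pbound T" "runs P f T" "pbound (\<lambda>x. esize (f x))"
  using assms unfolding polytime_def by blast

lemma runsE:
  assumes "runs P f T" "s 0 = enc x"
  obtains t s' where "exec P s t s'" "s' 0 = enc (f x)" "s' 1 = s 1" "t \<le> T x"
  using assms unfolding runs_def by blast

lemma exec_witness:
  assumes "exec P s t s'" "s' 0 = v" "s' 1 = s 1" "t \<le> T"
  shows "\<exists>t s'. exec P s t s' \<and> s' 0 = v \<and> s' 1 = s 1 \<and> t \<le> T"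
  using assms by blast

lemma polytime_compose:
  fixes g :: "'a::encodable \<Rightarrow> 'b::encodable" and f :: "'b \<Rightarrow> 'c::encodable"
  assumes "polytime f" "polytime g"
  shows "polytime (\<lambda>x. f (g x))"
proof -
  obtain P T where f: "pbound T" "runs P f T" "pbound (\<lambda>x. esize (f x))"
    using assms(1) by (rule polytimeE)
  obtain Q U where g: "pbound U" "runs Q g U" "pbound (\<lambda>x. esize (g x))"
    using assms(2) by (rule polytimeE)
  have "runs (Seq Q P) (\<lambda>x. f (g x)) (\<lambda>x. 1 + U x + T (g x))"
    unfolding runs_def
  proof (intro allI impI)
    fix s :: state and x :: 'a assume s: "s 0 = enc x"
    obtain t1 s1 where 1: "exec Q s t1 s1" "s1 0 = enc (g x)" "s1 1 = s 1" "t1 \<le> U x"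
      using g(2) s by (rule runsE)
    obtain t2 s2 where 2: "exec P s1 t2 s2" "s2 0 = enc (f (g x))" "s2 1 = s1 1" "t2 \<le> T (g x)"
      using f(2) 1(2) by (rule runsE)
    show "\<exists>t s'. exec (Seq Q P) s t s' \<and> s' 0 = enc (f (g x)) \<and> s' 1 = s 1 \<and> t \<le> 1 + U x + T (g x)"
      using exec_Seq[OF 1(1) 2(1)] 1 2 by (intro exI[of _ "1 + t1 + t2"] exI[of _ s2]) auto
  qed
  moreover have "pbound (\<lambda>x. 1 + U x + T (g x))"
    by (intro pbound_add pbound_const g(1) pbound_compose[OF f(1) g(3)])
  ultimately show ?thesis
    unfolding polytime_def using pbound_compose[OF f(3) g(3)] by blast
qed

lemma polytime_exp:
  fixes f :: "'a::encodable \<Rightarrow> 'b::encodable"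
  assumes "pbound (\<lambda>x. esize (f x))" "\<And>s x. s 0 = enc x \<Longrightarrow> exp_val e s = enc (f x)"
  shows "polytime f"
proof -
  have "runs (Assign 0 e) f (\<lambda>_. 1 + exp_cost e)"
    unfolding runs_def
  proof (intro allI impI)
    fix s :: state and x :: 'a assume "s 0 = enc x"
    then show "\<exists>t s'. exec (Assign 0 e) s t s' \<and> s' 0 = enc (f x) \<and> s' 1 = s 1 \<and> t \<le> 1 + exp_cost e"
      by (intro exec_witness[OF exec_Assign]) (use assms(2)[of s x] in auto)
  qed
  with assms(1) pbound_const show ?thesis unfolding polytime_def by blast
qed

lemma polytime_same_enc:
  assumes "\<And>x. enc (f x) = enc x"
  shows "polytime f"
  by (rule polytime_exp[where e = "Var 0"]) (simp_all add: assms pbound_esize)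

lemma polytime_id [polytime_intros]: "polytime (\<lambda>x. x)"
  by (rule polytime_same_enc) simp

primrec tree_exp :: "tree \<Rightarrow> exp" where
  "tree_exp Atom = Nil"
| "tree_exp (Pair l r) = Cons (tree_exp l) (tree_exp r)"

lemma exp_val_tree_exp: "exp_val (tree_exp t) s = t"
  by (induction t) auto

lemma polytime_const [polytime_intros]: "polytime (\<lambda>x. c)"
  by (rule polytime_exp[where e = "tree_exp (enc c)"]) (simp_all add: exp_val_tree_exp pbound_const)

lemma polytime_fst [polytime_intros]: "polytime f \<Longrightarrow> polytime (\<lambda>x. fst (f x))"
  by (rule polytime_compose, rule polytime_exp[where e = "Hd (Var 0)"])
    (auto intro: pbound_mono[OF pbound_esize] simp: enc_prod_def)

lemma polytime_snd [polytime_intros]: "polytime f \<Longrightarrow> polytime (\<lambda>x. snd (f x))"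
  by (rule polytime_compose, rule polytime_exp[where e = "Tl (Var 0)"])
    (auto intro: pbound_mono[OF pbound_esize] simp: enc_prod_def)

text \<open>Both components need the input. It waits on the stack while the first is computed; then
  the first result takes its place there while the second is computed.\<close>

lemma polytime_Pair [polytime_intros]:
  fixes f :: "'a::encodable \<Rightarrow> 'b::encodable" and g :: "'a \<Rightarrow> 'c::encodable"
  assumes "polytime f" "polytime g"
  shows "polytime (\<lambda>x. (f x, g x))"
proof -
  obtain P T where f: "pbound T" "runs P f T" "pbound (\<lambda>x. esize (f x))"
    using assms(1) by (rule polytimeE)
  obtain Q U where g: "pbound U" "runs Q g U" "pbound (\<lambda>x. esize (g x))"
    using assms(2) by (rule polytimeE)
  let ?c1 = "Assign 1 (Cons (Var 0) (Var 1))"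
  \<comment> \<open>Exchanges the top of the stack with variable 0, which holds the pair of both in
    between.\<close>
  let ?c2 = "Seq (Assign 0 (Cons (Hd (Var 1)) (Var 0)))
    (Seq (Assign 1 (Cons (Tl (Var 0)) (Tl (Var 1)))) (Assign 0 (Hd (Var 0))))"
  let ?c3 = "Seq (Assign 0 (Cons (Hd (Var 1)) (Var 0))) (Assign 1 (Tl (Var 1)))"
  let ?prog = "Seq ?c1 (Seq P (Seq ?c2 (Seq Q ?c3)))"
  have "runs ?prog (\<lambda>x. (f x, g x)) (\<lambda>x. 50 + T x + U x)"
    unfolding runs_def
  proof (intro allI impI)
    fix s :: state and x :: 'a assume s: "s 0 = enc x"
    define s1 where "s1 = s(1 := Pair (enc x) (s 1))"
    have e1: "exec ?c1 s 4 s1"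
      using exec_Assign[of 1 "Cons (Var 0) (Var 1)" s] s by (simp add: s1_def numeral_eq_Suc)
    have "s1 0 = enc x" using s by (simp add: s1_def)
    with f(2) obtain t2 s2 where 2: "exec P s1 t2 s2" "s2 0 = enc (f x)" "s2 1 = s1 1" "t2 \<le> T x"
      by (rule runsE)
    define s3 where "s3 = s2(0 := enc x, 1 := Pair (enc (f x)) (s 1))"
    have e3: "exec ?c2 s2 16 s3"
    proof -
      have "exec ?c2 s2 (1 + (1 + exp_cost (Cons (Hd (Var 1)) (Var 0)))
         + (1 + (1 + exp_cost (Cons (Tl (Var 0)) (Tl (Var 1)))) + (1 + exp_cost (Hd (Var 0))))) s3"
        by (rule exec_Seq exec_Assign)+ 
          (use exec_Assign[of 0 "Hd (Var 0)" "s2(0 := Pair (enc x) (enc (f x)), 1 := Pair (enc (f x)) (s 1))"] 2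
            in \<open>simp add: s3_def s1_def fun_upd_twist\<close>)
      then show ?thesis by (simp add: numeral_eq_Suc)
    qed
    have "s3 0 = enc x" by (simp add: s3_def)
    with g(2) obtain t4 s4 where 4: "exec Q s3 t4 s4" "s4 0 = enc (g x)" "s4 1 = s3 1" "t4 \<le> U x"
      by (rule runsE)
    define s5 where "s5 = s4(0 := Pair (enc (f x)) (enc (g x)), 1 := s 1)"
    have e5: "exec ?c3 s4 9 s5"
    proof -
      have "exec ?c3 s4 (1 + (1 + exp_cost (Cons (Hd (Var 1)) (Var 0))) + (1 + exp_cost (Tl (Var 1)))) s5"
        by (rule exec_Seq, rule exec_Assign)
          (use exec_Assign[of 1 "Tl (Var 1)" "s4(0 := Pair (enc (f x)) (enc (g x)))"] 4
            in \<open>simp add: s3_def s5_def\<close>)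
      then show ?thesis by (simp add: numeral_eq_Suc)
    qed
    have "exec ?prog s (1 + 4 + (1 + t2 + (1 + 16 + (1 + t4 + 9)))) s5"
      by (intro exec_Seq[OF e1] exec_Seq[OF 2(1)] exec_Seq[OF e3] exec_Seq[OF 4(1)] e5)
    then show "\<exists>t s'. exec ?prog s t s' \<and> s' 0 = enc (f x, g x) \<and> s' 1 = s 1 \<and> t \<le> 50 + T x + U x"
      by (rule exec_witness) (use 2 4 in \<open>simp_all add: s5_def\<close>)
  qed
  moreover have "pbound (\<lambda>x. 50 + T x + U x)"
    by (intro pbound_add pbound_const f(1) g(1))
  moreover have "pbound (\<lambda>x. esize (f x, g x))"
    by (simp add: pbound_add pbound_Suc f(3) g(3))
  ultimately show ?thesis unfolding polytime_def by blast
qed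

text \<open>\<open>False\<close> and the empty list are both encoded by the atom, so this one test
  yields negation as well as the test for emptiness.\<close>

lemma polytime_is_Atom: "polytime (\<lambda>x :: 'a::encodable. enc x = Atom)"
proof -
  let ?p = "If (Var 0) (Assign 0 Nil) (Assign 0 (Cons Nil Nil))"
  have "runs ?p (\<lambda>x :: 'a. enc x = Atom) (\<lambda>_. 10)"
    unfolding runs_def
  proof (intro allI impI)
    fix s :: state and x :: 'a assume s: "s 0 = enc x"
    show "\<exists>t s'. exec ?p s t s' \<and> s' 0 = enc (enc x = Atom) \<and> s' 1 = s 1 \<and> t \<le> 10"
    proof (cases "enc x = Atom")
      case True
      have "exec ?p s (1 + exp_cost (Var 0) + (1 + exp_cost (Cons Nil Nil))) (s(0 := exp_val (Cons Nil Nil) s))"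
        by (rule exec_IfFalse[OF _ exec_Assign]) (use s True in simp)
      then show ?thesis by (rule exec_witness) (use True in simp_all)
    next
      case False
      have "exec ?p s (1 + exp_cost (Var 0) + (1 + exp_cost Nil)) (s(0 := exp_val Nil s))"
        by (rule exec_IfTrue[OF _ exec_Assign]) (use s False in simp)
      then show ?thesis by (rule exec_witness) (use False in simp_all)
    qed
  qed
  moreover have "pbound (\<lambda>x::'a. esize (enc x = Atom))"
    by (rule pbound_mono[OF pbound_const[of 1]]) (rule esize_bool)
  ultimately show ?thesis unfolding polytime_def using pbound_const by blast
qed

lemma polytime_not [polytime_intros]: "polytime f \<Longrightarrow> polytime (\<lambda>x. \<not> f x)"
  using polytime_compose[OF polytime_is_Atom, of f] by simp

lemma polytime_null [polytime_intros]: "polytime f \<Longrightarrow> polytime (\<lambda>x. f x = [])"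
  using polytime_compose[OF polytime_is_Atom, of f] by simp

lemma polytime_if [polytime_intros]:
  fixes f :: "'a::encodable \<Rightarrow> 'b::encodable"
  assumes "polytime b" "polytime f" "polytime g"
  shows "polytime (\<lambda>x. if b x then f x else g x)"
proof -
  let ?h = "\<lambda>x. if b x then f x else g x"
  obtain B V where b: "pbound V" "runs B (\<lambda>x. (b x, x)) V"
    using polytime_Pair[OF assms(1) polytime_id] by (rule polytimeE)
  obtain P T where f: "pbound T" "runs P f T" "pbound (\<lambda>x. esize (f x))"
    using assms(2) by (rule polytimeE)
  obtain Q U where g: "pbound U" "runs Q g U" "pbound (\<lambda>x. esize (g x))"
    using assms(3) by (rule polytimeE)
  let ?r = "Assign 0 (Tl (Var 0))"
  let ?p = "Seq B (If (Hd (Var 0)) (Seq ?r P) (Seq ?r Q))"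
  have "runs ?p ?h (\<lambda>x. 20 + V x + T x + U x)"
    unfolding runs_def
  proof (intro allI impI)
    fix s :: state and x :: 'a assume s: "s 0 = enc x"
    obtain t1 s1 where 1: "exec B s t1 s1" "s1 0 = enc (b x, x)" "s1 1 = s 1" "t1 \<le> V x"
      using b(2) s by (rule runsE)
    define s2 where "s2 = s1(0 := enc x)"
    have r: "exec ?r s1 3 s2" using exec_Assign[of 0 "Tl (Var 0)" s1] 1 by (simp add: s2_def numeral_eq_Suc)
    have s2: "s2 0 = enc x" "s2 1 = s 1" using 1 by (auto simp: s2_def)
    show "\<exists>t s'. exec ?p s t s' \<and> s' 0 = enc (?h x) \<and> s' 1 = s 1 \<and> t \<le> 20 + V x + T x + U x"
    proof (cases "b x")
      case True
      obtain t3 s3 where 3: "exec P s2 t3 s3" "s3 0 = enc (f x)" "s3 1 = s2 1" "t3 \<le> T x"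
        using f(2) s2(1) by (rule runsE)
      have "exec ?p s (1 + t1 + (1 + exp_cost (Hd (Var 0)) + (1 + 3 + t3))) s3"
        by (rule exec_Seq[OF 1(1) exec_IfTrue[OF _ exec_Seq[OF r 3(1)]]]) (use 1 True in simp)
      then show ?thesis by (rule exec_witness) (use True 1 3 s2 in simp_all)
    next
      case False
      obtain t3 s3 where 3: "exec Q s2 t3 s3" "s3 0 = enc (g x)" "s3 1 = s2 1" "t3 \<le> U x"
        using g(2) s2(1) by (rule runsE)
      have "exec ?p s (1 + t1 + (1 + exp_cost (Hd (Var 0)) + (1 + 3 + t3))) s3"
        by (rule exec_Seq[OF 1(1) exec_IfFalse[OF _ exec_Seq[OF r 3(1)]]]) (use 1 False in simp)
      then show ?thesis by (rule exec_witness) (use False 1 3 s2 in simp_all)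
    qed
  qed
  moreover have "pbound (\<lambda>x. 20 + V x + T x + U x)"
    by (intro pbound_add pbound_const b(1) f(1) g(1))
  moreover have "pbound (\<lambda>x. esize (?h x))"
    by (rule pbound_mono[OF pbound_add[OF f(3) g(3)]]) simp
  ultimately show ?thesis unfolding polytime_def by blast
qed

lemma polytime_conj [polytime_intros]:
  assumes "polytime f" "polytime g"
  shows "polytime (\<lambda>x. f x \<and> g x)"
proof -
  have "(\<lambda>x. f x \<and> g x) = (\<lambda>x. if f x then g x else False)" by auto
  then show ?thesis by (simp only:) (intro polytime_if polytime_const assms)
qed

lemma polytime_disj [polytime_intros]:
  assumes "polytime f" "polytime g"
  shows "polytime (\<lambda>x. f x \<or> g x)"
proof -
  have "(\<lambda>x. f x \<or> g x) = (\<lambda>x. if f x then True else g x)" by auto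
  then show ?thesis by (simp only:) (intro polytime_if polytime_const assms)
qed

lemma polytime_imp [polytime_intros]:
  assumes "polytime f" "polytime g"
  shows "polytime (\<lambda>x. f x \<longrightarrow> g x)"
proof -
  have "(\<lambda>x. f x \<longrightarrow> g x) = (\<lambda>x. if f x then g x else True)" by auto
  then show ?thesis by (simp only:) (intro polytime_if polytime_const assms)
qed

lemma polytime_bool_eq [polytime_intros]:
  assumes "polytime f" "polytime g"
  shows "polytime (\<lambda>x. f x = (g x :: bool))"
proof -
  have "(\<lambda>x. f x = g x) = (\<lambda>x. if f x then g x else \<not> g x)" by auto
  then show ?thesis by (simp only:) (intro polytime_if polytime_not assms)
qed

lemma polytime_Cons [polytime_intros]:
  assumes "polytime f" "polytime g"
  shows "polytime (\<lambda>x. f x # g x)"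
proof -
  have "polytime (\<lambda>p. fst p # snd p)"
    by (rule polytime_exp[where e = "Var 0"]) (auto simp: enc_prod_def intro: pbound_mono[OF pbound_esize])
  from polytime_compose[OF this polytime_Pair[OF assms]] show ?thesis by simp
qed

lemma polytime_tl [polytime_intros]:
  fixes f :: "'a::encodable \<Rightarrow> 'b::encodable list"
  assumes "polytime f"
  shows "polytime (\<lambda>x. tl (f x))"
proof -
  have "enc (tl xs) = right (enc xs)" for xs :: "'b list"
    by (cases xs) auto
  moreover have "esize (tl xs) \<le> esize xs" for xs :: "'b list"
    by (cases xs) auto
  ultimately have "polytime (\<lambda>xs :: 'b list. tl xs)"
    by (intro polytime_exp[where e = "Tl (Var 0)"]) (auto intro: pbound_mono[OF pbound_esize])
  from polytime_compose[OF this assms] show ?thesis .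
qed

text \<open>The program forms \<open>(x, xs x)\<close>. If the list is \<open>y # ys\<close>, this
  tree is already the encoding of \<open>(x, y, ys)\<close>, the argument that the second branch
  expects.\<close>

lemma polytime_case_list [polytime_intros]:
  fixes xs :: "'a::encodable \<Rightarrow> 'b::encodable list"
  assumes "polytime xs" "polytime n" "polytime (\<lambda>p. c (fst p) (fst (snd p)) (snd (snd p)))"
  shows "polytime (\<lambda>x. case xs x of [] \<Rightarrow> n x | y # ys \<Rightarrow> c x y ys)"
proof -
  let ?h = "\<lambda>x. case xs x of [] \<Rightarrow> n x | y # ys \<Rightarrow> c x y ys"
  let ?c = "\<lambda>p. c (fst p) (fst (snd p)) (snd (snd p))"
  obtain B V where b: "pbound V" "runs B (\<lambda>x. (x, xs x)) V"
    using polytime_Pair[OF polytime_id assms(1)] by (rule polytimeE)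
  obtain P T where f: "pbound T" "runs P n T" "pbound (\<lambda>x. esize (n x))"
    using assms(2) by (rule polytimeE)
  obtain Q U where g: "pbound U" "runs Q ?c U" "pbound (\<lambda>p. esize (?c p))"
    using assms(3) by (rule polytimeE)
  obtain qU qs :: "nat poly" where qU: "\<And>p. U p \<le> poly qU (esize p)"
    and qs: "\<And>p. esize (?c p) \<le> poly qs (esize p)"
    using g(1,3) unfolding pbound_def by blast
  let ?sz = "\<lambda>x. Suc (esize x + esize (xs x))"
  have sz: "pbound (\<lambda>x. poly q (?sz x))" for q :: "nat poly"
  proof -
    have "pbound (\<lambda>p :: 'a \<times> 'b list. poly q (esize p))" unfolding pbound_def by blast
    from pbound_compose[OF this polytime_pbound[OF polytime_Pair[OF polytime_id assms(1)]]]
    show ?thesis by simp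
  qed
  let ?r = "Assign 0 (Hd (Var 0))"
  let ?p = "Seq B (If (Tl (Var 0)) Q (Seq ?r P))"
  have "runs ?p ?h (\<lambda>x. 20 + V x + T x + poly qU (?sz x))"
    unfolding runs_def
  proof (intro allI impI)
    fix s :: state and x :: 'a assume s: "s 0 = enc x"
    obtain t1 s1 where 1: "exec B s t1 s1" "s1 0 = enc (x, xs x)" "s1 1 = s 1" "t1 \<le> V x"
      using b(2) s by (rule runsE)
    show "\<exists>t s'. exec ?p s t s' \<and> s' 0 = enc (?h x) \<and> s' 1 = s 1 \<and> t \<le> 20 + V x + T x + poly qU (?sz x)"
    proof (cases "xs x")
      case [simp]: (Cons y ys)
      have "s1 0 = enc (x, y, ys)" using 1 by simp
      with g(2) obtain t3 s3 where 3: "exec Q s1 t3 s3" "s3 0 = enc (?c (x, y, ys))" "s3 1 = s1 1"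
        "t3 \<le> U (x, y, ys)"
        by (rule runsE)
      have "exec ?p s (1 + t1 + (1 + exp_cost (Tl (Var 0)) + t3)) s3"
        by (rule exec_Seq[OF 1(1) exec_IfTrue[OF _ 3(1)]]) (use 1 in simp)
      then show ?thesis
        by (rule exec_witness) (use 1 3 qU[of "(x, y, ys)"] in simp_all)
    next
      case [simp]: Nil
      define s2 where "s2 = s1(0 := enc x)"
      have r: "exec ?r s1 3 s2" using exec_Assign[of 0 "Hd (Var 0)" s1] 1 by (simp add: s2_def numeral_eq_Suc)
      have s2: "s2 0 = enc x" "s2 1 = s 1" using 1 by (auto simp: s2_def)
      obtain t3 s3 where 3: "exec P s2 t3 s3" "s3 0 = enc (n x)" "s3 1 = s2 1" "t3 \<le> T x"
        using f(2) s2(1) by (rule runsE)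
      have "exec ?p s (1 + t1 + (1 + exp_cost (Tl (Var 0)) + (1 + 3 + t3))) s3"
        by (rule exec_Seq[OF 1(1) exec_IfFalse[OF _ exec_Seq[OF r 3(1)]]]) (use 1 in simp)
      then show ?thesis by (rule exec_witness) (use 1 3 s2 in simp_all)
    qed
  qed
  moreover have "pbound (\<lambda>x. 20 + V x + T x + poly qU (?sz x))"
    by (intro pbound_add pbound_const b(1) f(1) sz)
  moreover have "pbound (\<lambda>x. esize (?h x))"
  proof (rule pbound_mono[OF pbound_add[OF f(3) sz[of qs]]])
    show "esize (?h x) \<le> esize (n x) + poly qs (?sz x)" for x
    proof (cases "xs x")
      case (Cons y ys)
      then show ?thesis using qs[of "(x, y, ys)"] by simp
    qed simp
  qed
  ultimately show ?thesis unfolding polytime_def by blast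
qed

section \<open>Iteration over lists\<close>

lemma esize_fold_le:
  assumes "I acc" "\<And>y acc. y \<in> set ys \<Longrightarrow> I acc \<Longrightarrow> I (f y acc)"
    and "\<And>y acc. y \<in> set ys \<Longrightarrow> I acc \<Longrightarrow> esize (f y acc) \<le> esize acc + r"
  shows "esize (fold f ys acc) \<le> esize acc + length ys * r"
  using assms
proof (induction ys arbitrary: acc)
  case (Cons y ys)
  have "esize (fold f ys (f y acc)) \<le> esize (f y acc) + length ys * r"
    using Cons.prems by (intro Cons.IH) auto
  with Cons.prems(3)[of y acc] Cons.prems(1) show ?case by simp
qed simp

text \<open>One round may enlarge the accumulator only by an amount \<open>r x\<close> that depends
  on the input and not on the accumulator; doubling in every round would be exponential. The
  invariant \<open>I\<close> restricts the accumulators for which this has to be shown.\<close>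

lemma polytime_fold:
  fixes xs :: "'x::encodable \<Rightarrow> 'y::encodable list" and b :: "'x \<Rightarrow> 'b::encodable"
  assumes xs: "polytime xs" and b: "polytime b"
    and f: "polytime (\<lambda>p. f (fst p) (fst (snd p)) (snd (snd p)))"
    and I0: "\<And>x. I x (b x)"
    and I: "\<And>x y acc. y \<in> set (xs x) \<Longrightarrow> I x acc \<Longrightarrow> I x (f x y acc)"
    and r: "pbound r"
    and growth: "\<And>x y acc. y \<in> set (xs x) \<Longrightarrow> I x acc \<Longrightarrow> esize (f x y acc) \<le> esize acc + r x"
  shows "polytime (\<lambda>x. fold (f x) (xs x) (b x))"
proof -
  let ?f = "\<lambda>p. f (fst p) (fst (snd p)) (snd (snd p))"
  obtain P T where P: "pbound T" "runs P (\<lambda>x. (xs x, b x, x)) T"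
    using polytime_Pair[OF xs polytime_Pair[OF b polytime_id]] by (rule polytimeE)
  obtain Q U where Q: "pbound U" "runs Q ?f U"
    using f by (rule polytimeE)
  obtain qU :: "nat poly" where qU: "\<And>p. U p \<le> poly qU (esize p)"
    using Q(1) unfolding pbound_def by blast
  \<comment> \<open>\<open>B x\<close> bounds every intermediate accumulator, with
    \<open>esize (xs x)\<close> in place of the number of rounds. \<open>D x\<close> bounds the time
    of one evaluation of \<open>f\<close>; the 2 accounts for the \<open>Pair\<close> cells of the
    triple \<open>(x, y, acc)\<close>.\<close>
  define B where "B x = esize (b x) + esize (xs x) * r x" for x
  define D where "D x = poly qU (2 + esize x + esize (xs x) + B x)" for x
  have B: "pbound B"
    unfolding B_def by (intro pbound_add pbound_mult r polytime_pbound xs b)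
  have D: "pbound D"
  proof -
    have "pbound (\<lambda>x. 2 + esize x + esize (xs x) + B x)"
      by (intro pbound_add pbound_const pbound_esize polytime_pbound xs B)
    then obtain q :: "nat poly" where q: "\<And>x. 2 + esize x + esize (xs x) + B x \<le> poly q (esize x)"
      unfolding pbound_def by blast
    have "D x \<le> poly (pcompose qU q) (esize x)" for x
      using poly_nat_mono[OF q] by (simp add: D_def poly_pcompose)
    then show ?thesis unfolding pbound_def by blast
  qed
  \<comment> \<open>A round starts with \<open>(y # ys, acc, x)\<close> in variable 0.
    \<open>?e1\<close> saves \<open>ys\<close> and \<open>x\<close> on the stack, \<open>?e2\<close>
    forms the argument \<open>(x, y, acc)\<close>, \<open>?e3\<close> rebuilds the loop state around
    the new accumulator, and \<open>?e4\<close> removes the two saved values.\<close>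
  let ?e1 = "Cons (Tl (Hd (Var 0))) (Cons (Tl (Tl (Var 0))) (Var 1))"
  let ?e2 = "Cons (Hd (Tl (Var 1))) (Cons (Hd (Hd (Var 0))) (Hd (Tl (Var 0))))"
  let ?e3 = "Cons (Hd (Var 1)) (Cons (Var 0) (Hd (Tl (Var 1))))"
  let ?e4 = "Tl (Tl (Var 1))"
  let ?body = "Seq (Assign 1 ?e1) (Seq (Assign 0 ?e2) (Seq Q (Seq (Assign 0 ?e3) (Assign 1 ?e4))))"
  let ?W = "While (Hd (Var 0)) ?body"
  \<comment> \<open>The last premise is a budget: the current size plus all that the remaining
    rounds may still add stays within \<open>B x\<close>.\<close>
  have loop: "\<exists>t s'. exec ?W s t s' \<and> s' 0 = enc ([] :: 'y list, fold (f x) ys acc, x) \<and> s' 1 = s 1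
      \<and> t \<le> 3 + length ys * (50 + D x)"
    if "s 0 = enc (ys, acc, x)" "set ys \<subseteq> set (xs x)" "I x acc" "esize acc + length ys * r x \<le> B x"
    for s x ys acc
    using that
  proof (induction ys arbitrary: s acc)
    case Nil
    have "exec ?W s (1 + exp_cost (Hd (Var 0))) s"
      by (rule exec_WhileFalse) (use Nil in simp)
    then show ?case by (rule exec_witness) (use Nil in simp_all)
  next
    case (Cons y ys)
    define s1 where "s1 = s(1 := Pair (enc ys) (Pair (enc x) (s 1)))"
    have 1: "exec (Assign 1 ?e1) s (1 + exp_cost ?e1) s1"
      using exec_Assign[of 1 ?e1 s] Cons.prems by (simp add: s1_def)
    define s2 where "s2 = s1(0 := enc (x, y, acc))"
    have 2: "exec (Assign 0 ?e2) s1 (1 + exp_cost ?e2) s2"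
      using exec_Assign[of 0 ?e2 s1] Cons.prems by (simp add: s1_def s2_def)
    have "s2 0 = enc (x, y, acc)" by (simp add: s2_def)
    with Q(2) obtain t3 s3 where 3: "exec Q s2 t3 s3" "s3 0 = enc (?f (x, y, acc))" "s3 1 = s2 1"
      "t3 \<le> U (x, y, acc)" by (rule runsE)
    define s4 where "s4 = s3(0 := enc (ys, f x y acc, x))"
    have 4: "exec (Assign 0 ?e3) s3 (1 + exp_cost ?e3) s4"
      using exec_Assign[of 0 ?e3 s3] 3 by (simp add: s1_def s2_def s4_def)
    define s5 where "s5 = s4(1 := s 1)"
    have 5: "exec (Assign 1 ?e4) s4 (1 + exp_cost ?e4) s5"
      using exec_Assign[of 1 ?e4 s4] 3 by (simp add: s1_def s2_def s4_def s5_def)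
    have y: "y \<in> set (xs x)" using Cons.prems by simp
    note g = growth[OF y Cons.prems(3)]
    have "\<exists>t s'. exec ?W s5 t s' \<and> s' 0 = enc ([] :: 'y list, fold (f x) ys (f x y acc), x) \<and> s' 1 = s5 1
      \<and> t \<le> 3 + length ys * (50 + D x)"
      using g Cons.prems I[OF y Cons.prems(3)] by (intro Cons.IH) (auto simp: s5_def s4_def)
    then obtain t6 s6 where 6: "exec ?W s5 t6 s6" "s6 0 = enc ([] :: 'y list, fold (f x) ys (f x y acc), x)"
      "s6 1 = s5 1" "t6 \<le> 3 + length ys * (50 + D x)" by blast
    have "U (x, y, acc) \<le> D x"
    proof -
      have "U (x, y, acc) \<le> poly qU (esize (x, y, acc))" by (rule qU)
      also have "\<dots> \<le> D x"
        unfolding D_def using Cons.prems(4) esize_le_of_mem[OF y] by (intro poly_nat_mono) simp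
      finally show ?thesis .
    qed
    with 3 have t3: "t3 \<le> D x" by simp
    have "exec ?W s (1 + exp_cost (Hd (Var 0)) + (1 + (1 + exp_cost ?e1) + (1 + (1 + exp_cost ?e2)
        + (1 + t3 + (1 + (1 + exp_cost ?e3) + (1 + exp_cost ?e4))))) + t6) s6"
      by (rule exec_WhileTrue[OF _ exec_Seq[OF 1 exec_Seq[OF 2 exec_Seq[OF 3(1) exec_Seq[OF 4 5]]]] 6(1)])
        (use Cons.prems in simp)
    then show ?case
      by (rule exec_witness) (use 6 t3 in \<open>simp_all add: s5_def\<close>)
  qed
  let ?prog = "Seq P (Seq ?W (Assign 0 (Hd (Tl (Var 0)))))"
  let ?g = "\<lambda>x. fold (f x) (xs x) (b x)"
  have "runs ?prog ?g (\<lambda>x. 20 + T x + esize (xs x) * (50 + D x))"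
    unfolding runs_def
  proof (intro allI impI)
    fix s :: state and x :: 'x assume s: "s 0 = enc x"
    obtain t1 s1 where 1: "exec P s t1 s1" "s1 0 = enc (xs x, b x, x)" "s1 1 = s 1" "t1 \<le> T x"
      using P(2) s by (rule runsE)
    have "length (xs x) * r x \<le> esize (xs x) * r x"
      by (intro mult_right_mono length_le_esize) simp
    then have "esize (b x) + length (xs x) * r x \<le> B x" by (simp add: B_def)
    from loop[of s1 "xs x" "b x" x, OF 1(2) subset_refl I0 this] obtain t2 s2 where 2: "exec ?W s1 t2 s2"
      "s2 0 = enc ([] :: 'y list, ?g x, x)" "s2 1 = s1 1" "t2 \<le> 3 + length (xs x) * (50 + D x)" by blast
    have "length (xs x) * (50 + D x) \<le> esize (xs x) * (50 + D x)"
      by (intro mult_right_mono length_le_esize) simp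
    with 2(4) have t2: "t2 \<le> 3 + esize (xs x) * (50 + D x)" by linarith
    from exec_Seq[OF 1(1) exec_Seq[OF 2(1) exec_Assign[of 0 "Hd (Tl (Var 0))"]]]
    show "\<exists>t s'. exec ?prog s t s' \<and> s' 0 = enc (?g x) \<and> s' 1 = s 1
        \<and> t \<le> 20 + T x + esize (xs x) * (50 + D x)"
      by (rule exec_witness) (use 1 2 t2 in simp_all)
  qed
  moreover have "pbound (\<lambda>x. 20 + T x + esize (xs x) * (50 + D x))"
    by (intro pbound_add pbound_mult pbound_const P(1) D polytime_pbound xs)
  moreover have "pbound (\<lambda>x. esize (?g x))"
  proof (rule pbound_mono[OF B])
    fix x
    have "esize (?g x) \<le> esize (b x) + length (xs x) * r x"
      by (rule esize_fold_le[of "I x"]) (use I0 I growth in auto)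
    also have "\<dots> \<le> B x" unfolding B_def by (intro add_left_mono mult_right_mono length_le_esize) simp
    finally show "esize (?g x) \<le> B x" .
  qed
  ultimately show ?thesis unfolding polytime_def by blast
qed

lemma polytime_fold_growth:
  assumes "polytime xs" "polytime b" "polytime (\<lambda>p. f (fst p) (fst (snd p)) (snd (snd p)))"
    and "pbound r"
    and "\<And>x y acc. y \<in> set (xs x) \<Longrightarrow> esize (f x y acc) \<le> esize acc + r x"
  shows "polytime (\<lambda>x. fold (f x) (xs x) (b x))"
  using assms by (intro polytime_fold[where I = "\<lambda>_ _. True" and r = r]) auto

section \<open>List operations obtained from folds\<close>

lemma polytime_rev [polytime_intros]:
  assumes "polytime xs"
  shows "polytime (\<lambda>x. rev (xs x))"
proof -
  have "polytime (\<lambda>x. fold (\<lambda>y acc. y # acc) (xs x) [])"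
    by (rule polytime_fold_growth[where r = "\<lambda>x. Suc (esize (xs x))"])
      (auto intro!: polytime_intros assms pbound_Suc polytime_pbound dest: esize_le_of_mem)
  moreover have "fold (\<lambda>y acc. y # acc) ys zs = rev ys @ zs" for ys zs :: "'b list"
    by (induction ys arbitrary: zs) auto
  ultimately show ?thesis by simp
qed

lemma polytime_foldr:
  assumes "polytime xs" "polytime b" "polytime (\<lambda>p. f (fst p) (fst (snd p)) (snd (snd p)))"
    and "\<And>x. I x (b x)"
    and "\<And>x y acc. y \<in> set (xs x) \<Longrightarrow> I x acc \<Longrightarrow> I x (f x y acc)"
    and "pbound r"
    and "\<And>x y acc. y \<in> set (xs x) \<Longrightarrow> I x acc \<Longrightarrow> esize (f x y acc) \<le> esize acc + r x"
  shows "polytime (\<lambda>x. foldr (f x) (xs x) (b x))"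
  unfolding foldr_conv_fold
  by (rule polytime_fold[where I = I and r = r]) (use assms in \<open>auto intro: polytime_rev\<close>)

lemma polytime_foldr_growth:
  assumes "polytime xs" "polytime b" "polytime (\<lambda>p. f (fst p) (fst (snd p)) (snd (snd p)))"
    and "pbound r"
    and "\<And>x y acc. y \<in> set (xs x) \<Longrightarrow> esize (f x y acc) \<le> esize acc + r x"
  shows "polytime (\<lambda>x. foldr (f x) (xs x) (b x))"
  using assms by (intro polytime_foldr[where I = "\<lambda>_ _. True" and r = r]) auto

lemma polytime_append [polytime_intros]:
  assumes "polytime xs" "polytime ys"
  shows "polytime (\<lambda>x. xs x @ ys x)"
proof -
  have "polytime (\<lambda>x. foldr (\<lambda>y acc. y # acc) (xs x) (ys x))"
    by (rule polytime_foldr_growth[where r = "\<lambda>x. Suc (esize (xs x))"])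
      (auto intro!: polytime_intros assms pbound_Suc polytime_pbound dest: esize_le_of_mem)
  moreover have "foldr (\<lambda>y acc. y # acc) us vs = us @ vs" for us vs :: "'b list"
    by (induction us) auto
  ultimately show ?thesis by simp
qed

lemma polytime_map [polytime_intros]:
  assumes "polytime xs" and f: "polytime (\<lambda>p. f (fst p) (snd p))"
  shows "polytime (\<lambda>x. map (f x) (xs x))"
proof -
  obtain q :: "nat poly" where q: "\<And>p. esize (f (fst p) (snd p)) \<le> poly q (esize p)"
    using polytime_pbound[OF f] unfolding pbound_def by blast
  let ?r = "\<lambda>x. Suc (poly q (esize (x, xs x)))"
  have "polytime (\<lambda>x. foldr (\<lambda>y acc. f x y # acc) (xs x) [])"
  proof (rule polytime_foldr_growth[where r = ?r])
    have "pbound (\<lambda>p. poly q (esize p))" for p :: "'a \<times> 'b list" unfolding pbound_def by blast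
    then show "pbound ?r"
      by (intro pbound_Suc pbound_compose[of "\<lambda>p. poly q (esize p)" "\<lambda>x. (x, xs x)"]
          polytime_pbound polytime_intros assms)
    show "esize (f x y # acc) \<le> esize acc + ?r x" if "y \<in> set (xs x)" for x y acc
    proof -
      have "esize (f x y) \<le> poly q (esize (x, y))" using q[of "(x, y)"] by simp
      also have "\<dots> \<le> poly q (esize (x, xs x))"
        using esize_le_of_mem[OF that] by (intro poly_nat_mono) simp
      finally show ?thesis by simp
    qed
    show "polytime (\<lambda>p. f (fst p) (fst (snd p)) # snd (snd p))"
      by (intro polytime_intros polytime_compose[OF f, of "\<lambda>p. (fst p, fst (snd p))", simplified])
  qed (intro polytime_intros assms)+
  moreover have "foldr (\<lambda>y acc. f x y # acc) ys [] = map (f x) ys" for x ys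
    by (induction ys) auto
  ultimately show ?thesis by simp
qed

lemma polytime_filter [polytime_intros]:
  fixes xs :: "'x::encodable \<Rightarrow> 'y::encodable list"
  assumes "polytime xs" and f: "polytime (\<lambda>p. f (fst p) (snd p))"
  shows "polytime (\<lambda>x. filter (f x) (xs x))"
proof -
  have *: "polytime (\<lambda>p :: 'x \<times> 'y \<times> 'y list. f (fst p) (fst (snd p)))"
    by (rule polytime_compose[OF f, of "\<lambda>p. (fst p, fst (snd p))", simplified]) (intro polytime_intros)
  have "polytime (\<lambda>x. foldr (\<lambda>y acc. if f x y then y # acc else acc) (xs x) [])"
    by (rule polytime_foldr_growth[where r = "\<lambda>x. Suc (esize (xs x))"])
      (auto intro!: * polytime_intros assms pbound_Suc polytime_pbound dest: esize_le_of_mem)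
  moreover have "foldr (\<lambda>y acc. if f x y then y # acc else acc) ys [] = filter (f x) ys" for x ys
    by (induction ys) auto
  ultimately show ?thesis by simp
qed

lemma polytime_concat [polytime_intros]:
  assumes "polytime xs"
  shows "polytime (\<lambda>x. concat (xs x))"
proof -
  have "polytime (\<lambda>x. foldr (\<lambda>y acc. y @ acc) (xs x) [])"
    by (rule polytime_foldr_growth[where r = "\<lambda>x. esize (xs x)"])
      (auto intro!: polytime_intros assms polytime_pbound dest: esize_le_of_mem simp: esize_append)
  then show ?thesis by (simp add: concat_conv_foldr)
qed

lemma polytime_Ball [polytime_intros]:
  assumes "polytime xs" and f: "polytime (\<lambda>p. f (fst p) (snd p))"
  shows "polytime (\<lambda>x. \<forall>y\<in>set (xs x). f x y)"
proof -
  have "polytime (\<lambda>x. filter (\<lambda>y. \<not> f x y) (xs x) = [])"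
    by (intro polytime_intros assms)
  moreover have "(\<lambda>x. filter (\<lambda>y. \<not> f x y) (xs x) = []) = (\<lambda>x. \<forall>y\<in>set (xs x). f x y)"
    by (simp add: filter_empty_conv)
  ultimately show ?thesis by simp
qed

lemma polytime_Bex [polytime_intros]:
  assumes "polytime xs" and f: "polytime (\<lambda>p. f (fst p) (snd p))"
  shows "polytime (\<lambda>x. \<exists>y\<in>set (xs x). f x y)"
proof -
  have "polytime (\<lambda>x. \<not> (\<forall>y\<in>set (xs x). \<not> f x y))"
    by (intro polytime_intros assms)
  then show ?thesis by simp
qed

section \<open>Trees as values, and equality tests\<close>

instantiation tree :: encodable
begin
definition enc_tree_def [simp]: "enc (t :: tree) = t"
instance ..
end

lemma polytime_enc [polytime_intros]: "polytime f \<Longrightarrow> polytime (\<lambda>x. enc (f x))"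
  by (rule polytime_compose[OF polytime_same_enc]) simp_all

text \<open>Trees encode themselves, so computing a value and computing its tree are the same task.
  In this way numbers can be produced as lists of bits.\<close>

lemma polytime_of_enc: "polytime (\<lambda>x. enc (f x)) \<Longrightarrow> polytime f"
  by (simp add: polytime_def runs_def)

lemma polytime_tree_Pair:
  fixes f g :: "'x::encodable \<Rightarrow> tree"
  assumes "polytime f" "polytime g"
  shows "polytime (\<lambda>x. tree.Pair (f x) (g x))"
  by (rule polytime_compose[OF polytime_same_enc[of "\<lambda>p. tree.Pair (fst p) (snd p)"] polytime_Pair[OF assms],
        simplified]) (simp add: enc_prod_def)

text \<open>The machine cannot compare trees in one step, so equality is shown to be computable
  along the structure of the type.\<close>

definition polytime_equality :: "'a::encodable itself \<Rightarrow> bool" where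
  "polytime_equality (_ :: 'a itself) \<longleftrightarrow> polytime (\<lambda>p. fst p = (snd p :: 'a))"

lemma polytime_eq [polytime_intros]:
  fixes f g :: "'x::encodable \<Rightarrow> 'a::encodable"
  assumes "polytime_equality TYPE('a)" "polytime f" "polytime g"
  shows "polytime (\<lambda>x. f x = g x)"
  using polytime_compose[OF assms(1)[unfolded polytime_equality_def] polytime_Pair[OF assms(2,3)]] by simp

lemma polytime_mem [polytime_intros]:
  fixes f :: "'x::encodable \<Rightarrow> 'a::encodable"
  assumes eq: "polytime_equality TYPE('a)" and f: "polytime f" and g: "polytime g"
  shows "polytime (\<lambda>x. f x \<in> set (g x))"
proof -
  have "polytime (\<lambda>x. \<exists>y\<in>set (g x). f x = y)"
    by (intro polytime_intros eq g polytime_compose[OF f])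
  then show ?thesis by simp
qed

lemma polytime_equality_bool [polytime_intros]: "polytime_equality TYPE(bool)"
  unfolding polytime_equality_def by (intro polytime_bool_eq polytime_intros)

lemma polytime_equality_prod [polytime_intros]:
  assumes "polytime_equality TYPE('a::encodable)" "polytime_equality TYPE('b::encodable)"
  shows "polytime_equality TYPE('a \<times> 'b)"
  unfolding polytime_equality_def prod_eq_iff by (intro polytime_intros assms)

text \<open>One round of a parallel scan: the list folded over is compared with the list in the
  state, whose unread rest is kept. If the second list runs out, the flag becomes false; a nonempty
  rest at the end also means inequality.\<close>

definition eq_step :: "'a \<Rightarrow> bool \<times> 'a list \<Rightarrow> bool \<times> 'a list" where
  "eq_step x s = (case snd s of [] \<Rightarrow> (False, []) | y # ys \<Rightarrow> (fst s \<and> x = y, ys))"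

lemma fold_eq_step: "fst (fold eq_step xs (b, ys)) \<and> snd (fold eq_step xs (b, ys)) = [] \<longleftrightarrow> b \<and> xs = ys"
proof (induction xs arbitrary: b ys)
  case (Cons x xs)
  then show ?case by (cases ys) (auto simp: eq_step_def)
qed auto

lemma polytime_equality_list [polytime_intros]:
  assumes eq: "polytime_equality TYPE('a::encodable)"
  shows "polytime_equality TYPE('a list)"
proof -
  have growth: "esize (eq_step x acc) \<le> esize acc + 1" for x :: 'a and acc
    by (cases acc) (auto simp: eq_step_def split: list.splits intro: order_trans[OF esize_bool])
  have f: "polytime (\<lambda>p :: ('a list \<times> 'a list) \<times> 'a \<times> bool \<times> 'a list. eq_step (fst (snd p)) (snd (snd p)))"
    unfolding eq_step_def by (intro polytime_intros eq)
  have *: "polytime (\<lambda>p :: 'a list \<times> 'a list. fold eq_step (fst p) (True, snd p))"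
    by (rule polytime_fold_growth[where r = "\<lambda>_. 1"]) (intro polytime_intros f pbound_const growth)+
  have "polytime (\<lambda>p :: 'a list \<times> 'a list. fst (fold eq_step (fst p) (True, snd p))
      \<and> snd (fold eq_step (fst p) (True, snd p)) = [])"
    by (intro polytime_intros *)
  then show ?thesis
    by (simp add: fold_eq_step polytime_equality_def)
qed

subsection \<open>Arithmetic on natural numbers in binary\<close>

text \<open>A number and its list of bits are the same tree, so programs on lists serve as programs
  on numbers.\<close>

lemma enc_nat_bits: "enc (nat_bits n) = enc n"
  by (simp add: enc_nat_def encode_nat_def enc_list_def enc_bool_def[abs_def])

lemma nat_bits_0 [simp]: "nat_bits 0 = []"
  by (simp add: nat_bits.simps)

lemma nat_bits_pos: "n > 0 \<Longrightarrow> nat_bits n = odd n # nat_bits (n div 2)"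
  by (simp add: nat_bits.simps[of n])

lemma nat_bits_inject: "nat_bits m = nat_bits n \<longleftrightarrow> m = n"
proof
  show "nat_bits m = nat_bits n \<Longrightarrow> m = n"
  proof (induction m arbitrary: n rule: nat_bits.induct)
    case (1 m)
    show ?case
    proof (cases "m = 0 \<or> n = 0")
      case True
      then show ?thesis using "1.prems" by (auto simp: nat_bits.simps split: if_splits)
    next
      case False
      then have "odd m = odd n" "m div 2 = n div 2"
        using "1.prems" "1.IH"[of "n div 2"] by (auto simp: nat_bits_pos)
      then show ?thesis by (metis even_two_times_div_two odd_two_times_div_two_succ)
    qed
  qed
qed simp

lemma enc_nat_0 [simp]: "enc (0::nat) = Atom"
  by (simp flip: enc_nat_bits)

lemma enc_nat_pos: "(n::nat) > 0 \<Longrightarrow> enc n = tree.Pair (enc (odd n)) (enc (n div 2))"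
  by (simp add: nat_bits_pos flip: enc_nat_bits)

lemma polytime_nat_bits [polytime_intros]: "polytime f \<Longrightarrow> polytime (\<lambda>x. nat_bits (f x))"
  by (rule polytime_compose[OF polytime_same_enc[OF enc_nat_bits]])

lemma polytime_equality_nat [polytime_intros]: "polytime_equality TYPE(nat)"
proof -
  have "polytime (\<lambda>p :: nat \<times> nat. nat_bits (fst p) = nat_bits (snd p))"
    by (intro polytime_intros)
  then show ?thesis
    by (simp add: nat_bits_inject polytime_equality_def)
qed

lemma polytime_odd [polytime_intros]:
  assumes "polytime f"
  shows "polytime (\<lambda>x. odd (f x :: nat))"
proof -
  have "polytime (\<lambda>x. case nat_bits (f x) of [] \<Rightarrow> False | b # bs \<Rightarrow> b)"
    by (intro polytime_intros assms)
  moreover have "(case nat_bits n of [] \<Rightarrow> False | b # bs \<Rightarrow> b) = odd n" for n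
    by (cases "n = 0") (simp_all add: nat_bits_pos)
  ultimately show ?thesis by simp
qed

lemma polytime_div2 [polytime_intros]:
  assumes "polytime f"
  shows "polytime (\<lambda>x. (f x :: nat) div 2)"
proof (rule polytime_of_enc)
  have "polytime (\<lambda>x. enc (tl (nat_bits (f x))))"
    by (intro polytime_intros assms)
  moreover have "enc (tl (nat_bits n)) = enc (n div 2)" for n
    by (cases "n = 0") (simp_all add: nat_bits_pos enc_nat_bits)
  ultimately show "polytime (\<lambda>x. enc (f x div 2))" by simp
qed

abbreviation shift_in :: "bool \<Rightarrow> nat \<Rightarrow> nat" where
  "shift_in d n \<equiv> 2 * n + of_bool d"

text \<open>Zero is the empty list of bits; shifting a bit 0 into it must not create a leading
  zero.\<close>

lemma enc_shift_in: "enc (shift_in d n) = (if n = 0 \<and> \<not> d then Atom else tree.Pair (enc d) (enc n))"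
  by (auto simp: enc_nat_pos)

lemma polytime_shift_in [polytime_intros]:
  assumes "polytime d" "polytime n"
  shows "polytime (\<lambda>x. shift_in (d x) (n x))"
proof (rule polytime_of_enc)
  show "polytime (\<lambda>x. enc (shift_in (d x) (n x)))"
    unfolding enc_shift_in by (intro polytime_intros polytime_tree_Pair assms)
qed

lemma esize_shift_in: "esize (shift_in d n) \<le> esize n + 2"
  unfolding enc_shift_in by (cases d) auto

lemma esize_div2: "esize ((n::nat) div 2) \<le> esize n"
  by (cases "n = 0") (auto simp: enc_nat_pos)

lemma esize_nat_le: "esize (n::nat) \<le> 2 * length (nat_bits n)"
proof (induction n rule: nat_bits.induct)
  case (1 n)
  then show ?case
    by (cases "n = 0") (auto simp: enc_nat_pos nat_bits_pos intro: order_trans[OF add_mono[OF esize_bool]])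
qed

lemma length_nat_bits_le: "n < 2 ^ k \<Longrightarrow> length (nat_bits n) \<le> k"
proof (induction k arbitrary: n)
  case (Suc k)
  show ?case
  proof (cases "n = 0")
    case False
    have "n div 2 < 2 ^ k" using Suc.prems by auto
    with Suc.IH False show ?thesis by (simp add: nat_bits_pos)
  qed simp
qed simp

lemma esize_less_power: "(n::nat) < 2 ^ k \<Longrightarrow> esize n \<le> 2 * k"
  using esize_nat_le[of n] length_nat_bits_le[of n k] by linarith

lemma fold_shift_in: "fold shift_in ds n = n * 2 ^ length ds + fold shift_in ds 0"
proof (induction ds arbitrary: n)
  case (Cons d ds)
  show ?case
    using Cons.IH[of "shift_in d n"] Cons.IH[of "of_bool d"] by (simp add: algebra_simps)
qed simp

text \<open>The length of the list \<open>us\<close> is a unary number: arithmetic is modulo \<open>2 ^ length us\<close>.\<close>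

definition add_step :: "'u \<Rightarrow> nat \<times> nat \<times> bool \<times> bool list \<Rightarrow> nat \<times> nat \<times> bool \<times> bool list" where
  "add_step u s = (let a = fst s; b = fst (snd s); c = fst (snd (snd s)) in
     (a div 2, b div 2, (odd a \<and> odd b) \<or> (c \<and> (odd a \<or> odd b)),
      ((odd a = odd b) = c) # snd (snd (snd s))))"

text \<open>A ripple-carry adder. The state of \<open>add_step\<close> consists of the unread parts
  of both summands, the carry and the digits found so far. The digits are stacked, so
  \<open>fold shift_in\<close> reads them from the most significant one down.\<close>

definition add_mod :: "'u list \<Rightarrow> nat \<Rightarrow> nat \<Rightarrow> nat" where
  "add_mod us a b = fold shift_in (snd (snd (snd (fold add_step us (a, b, False, []))))) 0"

text \<open>Horner's rule: \<open>foldr\<close> starts at the most significant bit of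
  \<open>a\<close>, doubles the accumulator for every bit and adds \<open>b\<close> for every bit
  1.\<close>

definition mult_mod :: "'u list \<Rightarrow> nat \<Rightarrow> nat \<Rightarrow> nat" where
  "mult_mod us a b = foldr (\<lambda>d acc. if d then add_mod us (add_mod us acc acc) b else add_mod us acc acc)
     (nat_bits a) 0"

text \<open>The number with \<open>length us\<close> bits 1, which represents -1.\<close>

definition minus_one_mod :: "'u list \<Rightarrow> nat" where
  "minus_one_mod us = fold (\<lambda>u. shift_in True) us 0"

lemma fold_add_step:
  "fold shift_in (snd (snd (snd (fold add_step us (a, b, c, ds))))) 0
   = fold shift_in ds 0 + 2 ^ length ds * ((a + b + of_bool c) mod 2 ^ length us)"
proof (induction us arbitrary: a b c ds)
  case (Cons u us)
  define c' where "c' = ((odd a \<and> odd b) \<or> (c \<and> (odd a \<or> odd b)))"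
  define d where "d = ((odd a = odd b) = c)"
  \<comment> \<open>The equation of a full adder with sum bit \<open>d\<close> and outgoing carry
    \<open>c'\<close>.\<close>
  have "a + b + of_bool c = of_bool d + 2 * (a div 2 + b div 2 + of_bool c')"
    unfolding c'_def d_def
    by (cases "odd a"; cases "odd b"; cases c) (auto elim!: oddE evenE)
  then have "(a + b + of_bool c) mod 2 ^ Suc (length us)
      = of_bool d + 2 * ((a div 2 + b div 2 + of_bool c') mod 2 ^ length us)"
    by (simp add: mod_mult2_eq div_add1_eq)
  moreover have "add_step u (a, b, c, ds) = (a div 2, b div 2, c', d # ds)"
    by (simp add: add_step_def c'_def d_def)
  ultimately show ?case
    using Cons.IH[of "a div 2" "b div 2" c' "d # ds"] fold_shift_in[of ds "of_bool d"]
    by (simp add: algebra_simps)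
qed simp

lemma add_mod_eq: "add_mod us a b = (a + b) mod 2 ^ length us"
  by (simp add: add_mod_def fold_add_step)

lemma mult_mod_eq: "mult_mod us a b = (a * b) mod 2 ^ length us"
proof (induction a rule: nat_bits.induct)
  case (1 a)
  show ?case
  proof (cases "a = 0")
    case False
    then have IH: "mult_mod us (a div 2) b = (a div 2 * b) mod 2 ^ length us" using 1 by simp
    have "mult_mod us a b = (if odd a then add_mod us (add_mod us (mult_mod us (a div 2) b) (mult_mod us (a div 2) b)) b
       else add_mod us (mult_mod us (a div 2) b) (mult_mod us (a div 2) b))"
      using False by (simp add: mult_mod_def nat_bits_pos)
    also have "\<dots> = (a div 2 * b + a div 2 * b + of_bool (odd a) * b) mod 2 ^ length us"
      by (simp add: add_mod_eq IH mod_simps)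
    also have "a div 2 * b + a div 2 * b + of_bool (odd a) * b = (2 * (a div 2) + of_bool (odd a)) * b"
      by (simp add: algebra_simps)
    also have "2 * (a div 2) + of_bool (odd a) = a"
      by (simp add: odd_two_times_div_two_succ)
    finally show ?thesis .
  qed (simp add: mult_mod_def)
qed

lemma minus_one_mod_eq: "minus_one_mod us + 1 = 2 ^ length us"
proof -
  have "fold (\<lambda>u. shift_in True) us n + 1 = (n + 1) * 2 ^ length us" for n
    by (induction us arbitrary: n) (auto simp: algebra_simps)
  then show ?thesis by (simp add: minus_one_mod_def)
qed

lemma polytime_add_mod [polytime_intros]:
  assumes "polytime us" "polytime a" "polytime b"
  shows "polytime (\<lambda>x. add_mod (us x) (a x) (b x))"
proof -
  have growth: "esize (add_step u acc) \<le> esize acc + 5" for u :: 'b and acc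
  proof (cases acc)
    case (fields a b c ds)
    then show ?thesis
      using esize_div2[of a] esize_div2[of b]
        esize_bool[of "(odd a \<and> odd b) \<or> (c \<and> (odd a \<or> odd b))"] esize_bool[of "(odd a = odd b) = c"]
      by (simp add: add_step_def)
  qed
  show ?thesis
    unfolding add_mod_def
  proof (rule polytime_fold_growth[where r = "\<lambda>_. 2"])
    have "polytime (\<lambda>x. fold add_step (us x) (a x, b x, False, []))"
      by (rule polytime_fold_growth[where r = "\<lambda>_. 5"])
        (unfold add_step_def Let_def, (intro polytime_intros assms pbound_const growth[unfolded add_step_def Let_def])+)
    then show "polytime (\<lambda>x. snd (snd (snd (fold add_step (us x) (a x, b x, False, [])))))"
      by (intro polytime_intros)
  qed (intro polytime_intros pbound_const esize_shift_in)+
qed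

text \<open>Every value that the fold produces is a residue and has at most \<open>length us\<close>
  bits, which is polynomial because the exponent of the modulus is given in unary.\<close>

lemma polytime_mult_mod [polytime_intros]:
  assumes us: "polytime us" and a: "polytime a" and b: "polytime b"
  shows "polytime (\<lambda>x. mult_mod (us x) (a x) (b x))"
  unfolding mult_mod_def
proof (rule polytime_foldr_growth[where r = "\<lambda>x. 2 * esize (us x)"])
  show "pbound (\<lambda>x. 2 * esize (us x))"
    by (intro pbound_mult pbound_const polytime_pbound us)
  have "esize (add_mod (us x) m n) \<le> 2 * esize (us x)" for x m n
    using esize_less_power[of "add_mod (us x) m n" "length (us x)"] length_le_esize[of "us x"]
    by (simp add: add_mod_eq)
  then show "esize (if y then add_mod (us x) (add_mod (us x) acc acc) (b x) else add_mod (us x) acc acc)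
    \<le> esize acc + 2 * esize (us x)" for x y acc
    by (simp add: trans_le_add2)
qed (intro polytime_intros us[THEN polytime_compose] b[THEN polytime_compose] a)+

lemma polytime_minus_one_mod [polytime_intros]:
  assumes "polytime us"
  shows "polytime (\<lambda>x. minus_one_mod (us x))"
  unfolding minus_one_mod_def
  by (rule polytime_fold_growth[where r = "\<lambda>_. 2"])
    (intro polytime_intros assms pbound_const esize_shift_in)+

section \<open>A signed count of weightings\<close>

abbreviation hits :: "'v list \<Rightarrow> 'v list \<Rightarrow> nat" where
  "hits A e \<equiv> length (filter (\<lambda>a. a \<in> set e) A)"

text \<open>\<open>A\<close> is the weighting decided so far, each vertex repeated as often as its
  weight, so \<open>hits A e\<close> is the weight of \<open>e\<close>. The three branches give
  \<open>x\<close> the weights 0, 1 and 2; the sign belongs to weight 1.\<close>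

primrec wsum :: "'v list \<Rightarrow> 'v list set \<Rightarrow> 'v list \<Rightarrow> int" where
  "wsum [] E A = (if \<forall>e\<in>E. 2 \<le> hits A e then 1 else 0)"
| "wsum (x # vs) E A = wsum vs E A - wsum vs E (x # A) + wsum vs E (x # x # A)"

lemma wsum_cong:
  assumes "\<And>e. e \<in> E \<Longrightarrow> hits A e = hits B e"
  shows "wsum vs E A = wsum vs E B"
  using assms
proof (induction vs arbitrary: A B)
  case (Cons x vs)
  have "wsum vs E A = wsum vs E B" "wsum vs E (x # A) = wsum vs E (x # B)"
    "wsum vs E (x # x # A) = wsum vs E (x # x # B)"
    using Cons.prems by (intro Cons.IH; simp)+
  then show ?case by simp
qed simp

text \<open>Weights only grow along the recursion, so an edge that is hit twice stays
  satisfied.\<close>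

lemma wsum_drop_satisfied:
  "wsum vs E A = wsum vs {e \<in> E. hits A e < 2} A"
proof (induction vs arbitrary: E A)
  case Nil
  then show ?case by auto
next
  case (Cons x vs)
  have "wsum vs E B = wsum vs {e \<in> E. hits A e < 2} B" if "\<And>e. hits A e \<le> hits B e" for B
  proof -
    have "{e \<in> {e \<in> E. hits A e < 2}. hits B e < 2} = {e \<in> E. hits B e < 2}"
      using that by (auto intro: le_less_trans)
    then show ?thesis using Cons.IH[of E B] Cons.IH[of "{e \<in> E. hits A e < 2}" B] by simp
  qed
  then show ?case by simp
qed

text \<open>All three branches have the same value, and 1 - 1 + 1 = 1.\<close>

lemma wsum_free_vertex:
  assumes "\<And>e. e \<in> E \<Longrightarrow> x \<notin> set e"
  shows "wsum (x # vs) E A = wsum vs E A"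
  using wsum_cong[of E "x # A" A vs] wsum_cong[of E "x # x # A" A vs] assms by simp

text \<open>A vertex of \<open>vs\<close> meets edges of at most one of the two sets. The factor for
  the other set has the same value in all three branches and can be taken out.\<close>

lemma wsum_Un:
  assumes "\<And>e f. e \<in> E \<Longrightarrow> f \<in> F \<Longrightarrow> set e \<inter> set f \<inter> set vs = {}"
  shows "wsum vs (E \<union> F) A = wsum vs E A * wsum vs F A"
  using assms
proof (induction vs arbitrary: A)
  case Nil
  then show ?case by auto
next
  case (Cons x vs)
  have IH: "wsum vs (E \<union> F) A = wsum vs E A * wsum vs F A" for A
    using Cons.prems by (intro Cons.IH) fastforce
  consider "\<And>e. e \<in> E \<Longrightarrow> x \<notin> set e" | "\<And>e. e \<in> F \<Longrightarrow> x \<notin> set e"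
    using Cons.prems by fastforce
  then show ?case
  proof cases
    case 1
    have "wsum (x # vs) E A = wsum vs E A" "wsum vs E (x # A) = wsum vs E A"
      "wsum vs E (x # x # A) = wsum vs E A"
      using 1 by (intro wsum_free_vertex wsum_cong; simp)+
    then show ?thesis by (simp add: IH algebra_simps del: wsum.simps(2) add: wsum.simps(2)[of x vs "E \<union> F"] wsum.simps(2)[of x vs F])
  next
    case 2
    have "wsum (x # vs) F A = wsum vs F A" "wsum vs F (x # A) = wsum vs F A"
      "wsum vs F (x # x # A) = wsum vs F A"
      using 2 by (intro wsum_free_vertex wsum_cong; simp)+
    then show ?thesis by (simp add: IH algebra_simps del: wsum.simps(2) add: wsum.simps(2)[of x vs "E \<union> F"] wsum.simps(2)[of x vs E])
  qed
qed

lemma wsum_empty: "wsum vs {} A = 1"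
  by (induction vs arbitrary: A) auto

lemma wsum_UN:
  assumes "finite I"
    and "\<And>i j e f. i \<in> I \<Longrightarrow> j \<in> I \<Longrightarrow> i \<noteq> j \<Longrightarrow> e \<in> C i \<Longrightarrow> f \<in> C j \<Longrightarrow> set e \<inter> set f \<inter> set vs = {}"
  shows "wsum vs (\<Union>i\<in>I. C i) A = (\<Prod>i\<in>I. wsum vs (C i) A)"
  using assms
proof (induction I rule: finite_induct)
  case (insert i I)
  have "wsum vs (C i \<union> (\<Union>j\<in>I. C j)) A = wsum vs (C i) A * wsum vs (\<Union>j\<in>I. C j) A"
    using insert.prems insert.hyps by (intro wsum_Un) blast
  moreover have "wsum vs (\<Union>j\<in>I. C j) A = (\<Prod>j\<in>I. wsum vs (C j) A)"
    using insert.prems by (intro insert.IH) blast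
  ultimately show ?case using insert.hyps by simp
qed (simp add: wsum_empty)

subsection \<open>Counting minimal transversals\<close>

lemma sum_Pow_insert:
  assumes "finite V" "x \<notin> V"
  shows "sum g (Pow (insert x V)) = sum g (Pow V) + (\<Sum>T\<in>Pow V. g (insert x T))"
proof -
  have "sum g (Pow (insert x V)) = sum g (Pow V) + sum g (insert x ` Pow V)"
    unfolding Pow_insert using assms by (intro sum.union_disjoint) auto
  also have "sum g (insert x ` Pow V) = (\<Sum>T\<in>Pow V. g (insert x T))"
    using assms(2) by (intro sum.reindex_cong[of "insert x"]) (auto intro!: inj_onI)
  finally show ?thesis .
qed

text \<open>\<open>T\<close> is the set of vertices of \<open>vs\<close> with nonzero weight and
  \<open>B\<close> the set of those with weight 1. An edge thus receives one unit for each of its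
  vertices in \<open>T\<close> and another for each in \<open>T - B\<close>.\<close>

lemma wsum_eq_sum:
  assumes "distinct vs"
  shows "wsum vs E A = (\<Sum>T\<in>Pow (set vs). \<Sum>B\<in>Pow T. (-1) ^ card B *
    (if \<forall>e\<in>E. 2 \<le> hits A e + card (T \<inter> set e) + card ((T - B) \<inter> set e) then 1 else 0))"
  using assms
proof (induction vs arbitrary: A)
  case (Cons x vs)
  define \<phi> :: "'a list \<Rightarrow> 'a set \<Rightarrow> 'a set \<Rightarrow> int" where "\<phi> A T B = (-1) ^ card B *
    (if \<forall>e\<in>E. 2 \<le> hits A e + card (T \<inter> set e) + card ((T - B) \<inter> set e) then 1 else 0)" for A T B
  have IH: "wsum vs E A = (\<Sum>T\<in>Pow (set vs). \<Sum>B\<in>Pow T. \<phi> A T B)" for A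
    unfolding \<phi>_def using Cons by simp
  have x: "x \<notin> set vs" using Cons.prems by simp
  \<comment> \<open>Adding \<open>x\<close> to \<open>T\<close> alone gives it weight 2; adding it
    to \<open>B\<close> as well gives it weight 1 and flips the sign.\<close>
  have 1: "\<phi> A (insert x T) B = \<phi> (x # x # A) T B" if "T \<subseteq> set vs" "B \<subseteq> T" for T B
  proof -
    have "finite T" "x \<notin> T" "x \<notin> B" using that x by (auto intro: finite_subset)
    then have "hits A e + card (insert x T \<inter> set e) + card ((insert x T - B) \<inter> set e)
      = hits (x # x # A) e + card (T \<inter> set e) + card ((T - B) \<inter> set e)" for e
      by (simp add: insert_Diff_if)
    then show ?thesis by (simp add: \<phi>_def)
  qed
  have 2: "\<phi> A (insert x T) (insert x B) = - \<phi> (x # A) T B" if "T \<subseteq> set vs" "B \<subseteq> T" for T B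
  proof -
    have fin: "finite T" "x \<notin> T" "x \<notin> B" "finite B" using that x by (auto intro: finite_subset)
    then have "hits A e + card (insert x T \<inter> set e) + card ((insert x T - insert x B) \<inter> set e)
      = hits (x # A) e + card (T \<inter> set e) + card ((T - B) \<inter> set e)" for e
      by simp
    then show ?thesis using fin by (simp add: \<phi>_def)
  qed
  have "(\<Sum>B\<in>Pow (insert x T). \<phi> A (insert x T) B)
      = (\<Sum>B\<in>Pow T. \<phi> (x # x # A) T B) - (\<Sum>B\<in>Pow T. \<phi> (x # A) T B)" if "T \<subseteq> set vs" for T
  proof -
    have "finite T" "x \<notin> T" using that x by (auto intro: finite_subset)
    then show ?thesis using 1[OF that] 2[OF that] by (simp add: sum_Pow_insert sum_negf)
  qed
  then have "(\<Sum>T\<in>Pow (set (x # vs)). \<Sum>B\<in>Pow T. \<phi> A T B) = wsum (x # vs) E A"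
    using x by (simp add: sum_Pow_insert IH sum_subtractf)
  then show ?case unfolding \<phi>_def ..
qed simp

lemma sum_alternating_Pow:
  "finite U \<Longrightarrow> (\<Sum>B\<in>Pow U. (-1) ^ card B) = (if U = {} then 1 else 0 :: int)"
proof (induction U rule: finite_induct)
  case (insert x U)
  have "(\<Sum>B\<in>Pow U. (-1) ^ card (insert x B)) = (\<Sum>B\<in>Pow U. - ((-1) ^ card B) :: int)"
  proof (rule sum.cong)
    fix B assume "B \<in> Pow U"
    then have "finite B" "x \<notin> B" using insert.hyps by (auto intro: finite_subset)
    then show "(-1) ^ card (insert x B) = - ((-1) ^ card B :: int)" by simp
  qed simp
  then show ?case using insert.hyps by (simp add: sum_Pow_insert sum_negf)
qed simp

text \<open>Removing \<open>x\<close> fails exactly if some edge meets \<open>T\<close> only in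
  \<open>x\<close>. A proper subset of \<open>T\<close> lacks some vertex and therefore misses the
  private edge of that vertex.\<close>

lemma minimal_transversal_iff:
  "minimal_transversal H T \<longleftrightarrow> transversal H T \<and> (\<forall>x\<in>T. \<exists>e\<in>H. T \<inter> e = {x})"
proof (intro iffI conjI ballI)
  assume m: "minimal_transversal H T"
  then show t: "transversal H T" by (simp add: minimal_transversal_def)
  fix x assume x: "x \<in> T"
  then have "T - {x} \<subset> T" by blast
  with m have "\<not> transversal H (T - {x})" by (simp add: minimal_transversal_def)
  with t obtain e where "e \<in> H" "(T - {x}) \<inter> e = {}" unfolding transversal_def by blast
  moreover have "T \<inter> e \<noteq> {}" using t \<open>e \<in> H\<close> unfolding transversal_def by blast
  ultimately have "T \<inter> e = {x}" by blast
  with \<open>e \<in> H\<close> show "\<exists>e\<in>H. T \<inter> e = {x}" by blast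
next
  assume *: "transversal H T \<and> (\<forall>x\<in>T. \<exists>e\<in>H. T \<inter> e = {x})"
  have "\<not> transversal H T'" if "T' \<subset> T" for T'
  proof -
    from that obtain x where "x \<in> T" "x \<notin> T'" by blast
    with * obtain e where "e \<in> H" "T \<inter> e = {x}" by blast
    with \<open>x \<notin> T'\<close> that have "T' \<inter> e = {}" by auto
    with \<open>e \<in> H\<close> show ?thesis by (auto simp: transversal_def)
  qed
  with * show "minimal_transversal H T" by (simp add: minimal_transversal_def)
qed

text \<open>The alternating sum over the sets \<open>B\<close> of vertices of weight 1 cancels unless every vertex of
  \<open>T\<close> has a private edge.\<close>

lemma wsum_eq_card:
  assumes "distinct vs" "set vs = vertices (set ` E)"
  shows "wsum vs E [] = int (card {T. minimal_transversal (set ` E) T})"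
proof -
  let ?H = "set ` E"
  \<comment> \<open>The vertices of \<open>T\<close> without a private edge. If \<open>T\<close> is
    a transversal, the admissible sets \<open>B\<close> are the subsets of \<open>U T\<close>, so
    their alternating sum vanishes unless \<open>U T\<close> is empty.\<close>
  define U where "U T = {x \<in> T. \<not> (\<exists>e\<in>?H. T \<inter> e = {x})}" for T
  have inner: "(\<Sum>B\<in>Pow T. (-1) ^ card B *
      (if \<forall>e\<in>E. 2 \<le> hits [] e + card (T \<inter> set e) + card ((T - B) \<inter> set e) then 1 else 0))
     = (if minimal_transversal ?H T then 1 else 0 :: int)" if T: "T \<subseteq> set vs" for T
  proof -
    have fin: "finite T" using T finite_subset by blast
    \<comment> \<open>The weight of \<open>e\<close> is below 2 exactly if \<open>T\<close> misses
      \<open>e\<close> or meets it in a single vertex, and that vertex has weight 1.\<close>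
    have key: "2 \<le> card (T \<inter> set e) + card ((T - B) \<inter> set e) \<longleftrightarrow>
      T \<inter> set e \<noteq> {} \<and> \<not> (\<exists>b\<in>B. T \<inter> set e = {b})" if "B \<subseteq> T" for B e
    proof (cases "card (T \<inter> set e) \<le> 1")
      case False
      then have "T \<inter> set e \<noteq> {}" "T \<inter> set e \<noteq> {b}" for b by auto
      with False show ?thesis by auto
    next
      case True
      then consider "T \<inter> set e = {}" | b where "T \<inter> set e = {b}"
        using fin by (cases "card (T \<inter> set e)") (auto simp: card_Suc_eq)
      then show ?thesis
      proof cases
        case 1
        then have "(T - B) \<inter> set e = {}" by blast
        with 1 show ?thesis by simp
      next
        case 2
        then have "(T - B) \<inter> set e = {b} - B" by blast
        with 2 show ?thesis by (cases "b \<in> B") (auto simp: insert_Diff_if)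
      qed
    qed
    have "(\<Sum>B\<in>Pow T. (-1) ^ card B *
      (if \<forall>e\<in>E. 2 \<le> hits [] e + card (T \<inter> set e) + card ((T - B) \<inter> set e) then 1 else 0))
      = (\<Sum>B\<in>Pow T. if transversal ?H T \<and> B \<subseteq> U T then (-1) ^ card B else 0 :: int)"
    proof (rule sum.cong)
      fix B assume "B \<in> Pow T"
      then have "B \<subseteq> T" by simp
      from key[OF this]
      have "(\<forall>e\<in>E. 2 \<le> hits [] e + card (T \<inter> set e) + card ((T - B) \<inter> set e)) \<longleftrightarrow>
        transversal ?H T \<and> B \<subseteq> U T"
        using T \<open>B \<subseteq> T\<close> assms(2) unfolding transversal_def U_def by auto
      then show "(-1) ^ card B *
          (if \<forall>e\<in>E. 2 \<le> hits [] e + card (T \<inter> set e) + card ((T - B) \<inter> set e) then 1 else 0)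
        = (if transversal ?H T \<and> B \<subseteq> U T then (-1) ^ card B else 0 :: int)" by simp
    qed simp
    also have "\<dots> = (if transversal ?H T then (\<Sum>B\<in>Pow (U T). (-1) ^ card B) else 0)"
    proof -
      have "Pow T \<inter> {B. B \<subseteq> U T} = Pow (U T)" by (auto simp: U_def)
      then show ?thesis using fin by (simp add: sum.If_cases)
    qed
    also have "\<dots> = (if transversal ?H T \<and> U T = {} then 1 else 0)"
      using fin by (simp add: sum_alternating_Pow U_def)
    also have "transversal ?H T \<and> U T = {} \<longleftrightarrow> minimal_transversal ?H T"
      unfolding minimal_transversal_iff U_def by blast
    finally show ?thesis .
  qed
  have "{T. minimal_transversal ?H T} = Pow (set vs) \<inter> {T. minimal_transversal ?H T}"
    using assms(2) by (auto simp: minimal_transversal_def transversal_def)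
  then show ?thesis
    using inner by (simp add: wsum_eq_sum[OF assms(1)] sum.If_cases)
qed

section \<open>Components\<close>

definition shares :: "'v list \<Rightarrow> 'v list \<Rightarrow> 'v list \<Rightarrow> bool" where
  "shares vs e f \<longleftrightarrow> (\<exists>z\<in>set e. z \<in> set f \<and> z \<in> set vs)"

text \<open>Adjacency of edges through \<open>vs\<close>, directed forward in the list so that there
  are no cycles.\<close>

primrec up :: "'v list \<Rightarrow> 'v list list \<Rightarrow> ('v list \<times> 'v list) set" where
  "up vs [] = {}"
| "up vs (h # E) = {(h, g) | g. g \<in> set E \<and> shares vs h g} \<union> up vs E"

text \<open>The list is scanned from its end, so an edge is decided after all edges to which it has
  a step. The edges collected are those with a walk along \<open>up\<close> to
  \<open>e\<close>.\<close>

definition component :: "'v list \<Rightarrow> 'v list list \<Rightarrow> 'v list \<Rightarrow> 'v list list" where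
  "component vs E e = foldr (\<lambda>f acc. if f = e \<or> (\<exists>g\<in>set acc. shares vs f g) then f # acc else acc) E []"

lemma component_Nil [simp]: "component vs [] e = []"
  by (simp add: component_def)

lemma component_Cons [simp]: "component vs (h # E) e =
  (if h = e \<or> (\<exists>g\<in>set (component vs E e). shares vs h g) then h # component vs E e else component vs E e)"
  by (simp add: component_def)

lemma component_subset: "set (component vs E e) \<subseteq> set E"
  by (induction E) auto

lemma distinct_component: "distinct E \<Longrightarrow> distinct (component vs E e)"
  by (induction E) (use component_subset in auto)

lemma up_subset: "up vs E \<subseteq> set E \<times> set E"
  by (induction E) auto

lemma up_mono: "set vs \<subseteq> set vs' \<Longrightarrow> up vs E \<subseteq> up vs' E"
  by (induction E) (auto simp: shares_def)

lemma up_shares: "(f, g) \<in> up vs E \<Longrightarrow> shares vs f g"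
  by (induction E) auto

lemma up_sorted_wrt: "(f, g) \<in> up vs E \<Longrightarrow> sorted_wrt P E \<Longrightarrow> P f g"
  by (induction E) auto

lemma up_total:
  "shares vs f g \<Longrightarrow> f \<in> set E \<Longrightarrow> g \<in> set E \<Longrightarrow> f \<noteq> g \<Longrightarrow> (f, g) \<in> up vs E \<or> (g, f) \<in> up vs E"
  by (induction E) (auto simp: shares_def)

lemma up_Range: "h \<notin> set E \<Longrightarrow> (f, h) \<in> (up vs (h # E))\<^sup>* \<Longrightarrow> f = h"
  using up_subset[of vs E] by (auto elim: rtranclE)

text \<open>No step leads into the first edge of the list, so a walk that starts behind it stays in
  the tail.\<close>

lemma up_tail:
  assumes "h \<notin> set E" "(f, e) \<in> (up vs (h # E))\<^sup>*" "f \<in> set E"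
  shows "(f, e) \<in> (up vs E)\<^sup>*"
  using assms(2,3)
proof (induction rule: converse_rtrancl_induct)
  case (step f g)
  then have "(f, g) \<in> up vs E" using assms(1) by auto
  with step up_subset[of vs E] show ?case by (blast intro: converse_rtrancl_into_rtrancl)
qed simp

lemma up_antisym:
  assumes "distinct E" "(f, g) \<in> (up vs E)\<^sup>*" "(g, f) \<in> (up vs E)\<^sup>*"
  shows "f = g"
  using assms
proof (induction E)
  case (Cons h E)
  have h: "h \<notin> set E" using Cons.prems by simp
  show ?case
  proof (rule ccontr)
    assume "f \<noteq> g"
    then have "f \<in> set (h # E)" "g \<in> set (h # E)"
      using Cons.prems up_subset[of vs "h # E"] by (blast elim: converse_rtranclE)+
    moreover have "f \<noteq> h" "g \<noteq> h"
      using up_Range[OF h] Cons.prems \<open>f \<noteq> g\<close> by blast+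
    ultimately have "(f, g) \<in> (up vs E)\<^sup>*" "(g, f) \<in> (up vs E)\<^sup>*"
      using up_tail[OF h] Cons.prems by auto
    with Cons \<open>f \<noteq> g\<close> show False by simp
  qed
qed simp

text \<open>Induction on the list: a new first edge only adds steps that leave it, so the membership
  of all other edges is unchanged.\<close>

lemma set_component:
  assumes "distinct E" "e \<in> set E"
  shows "set (component vs E e) = {f. (f, e) \<in> (up vs E)\<^sup>*}"
proof -
  \<comment> \<open>The membership of \<open>e\<close> is part of the equivalence because the
    induction passes through tails that do not contain \<open>e\<close>.\<close>
  have "f \<in> set (component vs E e) \<longleftrightarrow> f \<in> set E \<and> e \<in> set E \<and> (f, e) \<in> (up vs E)\<^sup>*" for f
    using assms(1)
  proof (induction E arbitrary: f)
    case (Cons h E)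
    have h: "h \<notin> set E" using Cons.prems by simp
    have IH: "f \<in> set (component vs E e) \<longleftrightarrow> f \<in> set E \<and> e \<in> set E \<and> (f, e) \<in> (up vs E)\<^sup>*" for f
      using Cons by simp
    have tl: "(f, e) \<in> (up vs (h # E))\<^sup>* \<longleftrightarrow> (f, e) \<in> (up vs E)\<^sup>*" if "f \<in> set E" for f
      using up_tail[OF h _ that] rtrancl_mono[of "up vs E" "up vs (h # E)"] by auto
    have E: "e \<in> set E" if "(f, e) \<in> (up vs E)\<^sup>*" "f \<in> set E" for f
      using that up_subset[of vs E] by (auto elim: rtranclE)
    have hd: "(h, e) \<in> (up vs (h # E))\<^sup>* \<longleftrightarrow> h = e \<or> (\<exists>g\<in>set (component vs E e). shares vs h g)"
    proof
      assume "(h, e) \<in> (up vs (h # E))\<^sup>*"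
      then show "h = e \<or> (\<exists>g\<in>set (component vs E e). shares vs h g)"
      proof (cases rule: converse_rtranclE)
        case (step g)
        then have "g \<in> set E" "shares vs h g" using h up_subset[of vs E] by auto
        then show ?thesis using step(2) tl E IH by blast
      qed simp
    next
      assume "h = e \<or> (\<exists>g\<in>set (component vs E e). shares vs h g)"
      then show "(h, e) \<in> (up vs (h # E))\<^sup>*"
      proof
        assume "\<exists>g\<in>set (component vs E e). shares vs h g"
        then obtain g where g: "g \<in> set E" "(g, e) \<in> (up vs E)\<^sup>*" "shares vs h g" using IH by blast
        then have "(h, g) \<in> up vs (h # E)" by simp
        moreover have "(g, e) \<in> (up vs (h # E))\<^sup>*" using g tl by blast
        ultimately show ?thesis by (rule converse_rtrancl_into_rtrancl)
      qed simp
    qed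
    show ?case
    proof (cases "f = h")
      case True
      have "h \<notin> set (component vs E e)" using h component_subset[of vs E e] by blast
      moreover have "e \<in> set (h # E)" if "(h, e) \<in> (up vs (h # E))\<^sup>*"
        using that up_subset[of vs "h # E"] by (auto elim: rtranclE)
      ultimately show ?thesis using True hd by auto
    next
      case False
      then have "f \<in> set (component vs (h # E) e) \<longleftrightarrow> f \<in> set (component vs E e)" by simp
      with IH tl E False show ?thesis by auto
    qed
  qed simp
  moreover have "f \<in> set E" if "(f, e) \<in> (up vs E)\<^sup>*" for f
    using that assms(2) up_subset[of vs E] by (blast elim: converse_rtranclE)
  ultimately show ?thesis using assms(2) by blast
qed

text \<open>What the lexicographic order of the edges provides: if the earlier edge \<open>f\<close>
  and the later edge \<open>g\<close> share a vertex, then \<open>f\<close> is contained in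
  \<open>g\<close> beyond it.\<close>

definition dominated :: "'v list \<Rightarrow> 'v list \<Rightarrow> 'v list \<Rightarrow> bool" where
  "dominated xs f g \<longleftrightarrow>
     (\<forall>us z ws. xs = us @ z # ws \<longrightarrow> z \<in> set f \<longrightarrow> z \<in> set g \<longrightarrow> set f \<inter> set ws \<subseteq> set g)"

text \<open>The edges of \<open>R\<close> that are maximal with respect to walks. For sorted edges
  and \<open>R\<close> closed under components, their components partition \<open>R\<close>.\<close>

definition roots :: "'v list \<Rightarrow> 'v list list \<Rightarrow> 'v list list \<Rightarrow> 'v list list" where
  "roots vs E R = filter (\<lambda>f. \<forall>g\<in>set R. f \<in> set (component vs E g) \<longrightarrow> g = f) R"

locale sorted_edges =
  fixes xs :: "'v list" and E :: "'v list list"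
  assumes distinct_vertices: "distinct xs"
    and distinct_edges: "distinct E"
    and sorted: "sorted_wrt (dominated xs) E"
    and covered: "\<And>e. e \<in> set E \<Longrightarrow> set e \<subseteq> set xs"
begin

section \<open>Laminarity of the components\<close>

lemma mem_component_iff:
  "e \<in> set E \<Longrightarrow> f \<in> set (component vs E e) \<longleftrightarrow> (f, e) \<in> (up vs E)\<^sup>*"
  using set_component[OF distinct_edges] by blast

text \<open>Let \<open>f\<close> meet \<open>g1\<close> in \<open>y1\<close> and \<open>g2\<close>
  in \<open>y2\<close>. Whichever of the two vertices comes later in \<open>xs\<close> lies in both
  \<open>g1\<close> and \<open>g2\<close>, because both dominate \<open>f\<close>.\<close>

lemma up_up_shares:
  assumes "set vs \<subseteq> set xs" "(f, g1) \<in> up vs E" "(f, g2) \<in> up vs E"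
  shows "shares vs g1 g2"
proof -
  obtain y1 where y1: "y1 \<in> set f" "y1 \<in> set g1" "y1 \<in> set vs"
    using up_shares[OF assms(2)] by (auto simp: shares_def)
  obtain y2 where y2: "y2 \<in> set f" "y2 \<in> set g2" "y2 \<in> set vs"
    using up_shares[OF assms(3)] by (auto simp: shares_def)
  have d: "dominated xs f g1" "dominated xs f g2"
    using assms sorted by (auto intro: up_sorted_wrt)
  from y1 assms(1) obtain us ws where xs: "xs = us @ y1 # ws" by (meson split_list subsetD)
  then consider "y2 = y1" | "y2 \<in> set ws" | "y2 \<in> set us" using y2 assms(1) by auto
  then have "y2 \<in> set g1 \<or> y1 \<in> set g2"
  proof cases
    case 1
    with y2 show ?thesis by simp
  next
    case 2
    with d(1) xs y1 y2 show ?thesis unfolding dominated_def by blast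
  next
    case 3
    then obtain us' us'' where "us = us' @ y2 # us''" by (meson split_list)
    then have "xs = us' @ y2 # (us'' @ y1 # ws)" using xs by simp
    with d(2) y1 y2 have "set f \<inter> set (us'' @ y1 # ws) \<subseteq> set g2" unfolding dominated_def by blast
    with y1 show ?thesis by auto
  qed
  with y1 y2 show ?thesis by (auto simp: shares_def)
qed

lemma up_up_comparable:
  assumes "set vs \<subseteq> set xs" "(f, g1) \<in> up vs E" "(f, g2) \<in> up vs E"
  shows "g1 = g2 \<or> (g1, g2) \<in> up vs E \<or> (g2, g1) \<in> up vs E"
proof -
  have "g1 \<in> set E" "g2 \<in> set E" using assms(2,3) up_subset[of vs E] by auto
  then show ?thesis using up_total[OF up_up_shares[OF assms]] by auto
qed

lemma up_rtrancl_comparable_step: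
  assumes "set vs \<subseteq> set xs" "(f, h) \<in> (up vs E)\<^sup>*" "(f, g) \<in> up vs E"
  shows "(g, h) \<in> (up vs E)\<^sup>* \<or> (h, g) \<in> (up vs E)\<^sup>*"
  using assms(2,3)
proof (induction arbitrary: g rule: converse_rtrancl_induct)
  case (step f f')
  from up_up_comparable[OF assms(1) step.prems step.hyps(1)] step.IH step.hyps(2)
  show ?case by (meson converse_rtrancl_into_rtrancl)
qed auto

text \<open>The edges reachable from \<open>f\<close> form a chain, so components with a common edge
  are nested.\<close>

lemma up_rtrancl_comparable:
  assumes "set vs \<subseteq> set xs" "(f, g) \<in> (up vs E)\<^sup>*" "(f, h) \<in> (up vs E)\<^sup>*"
  shows "(g, h) \<in> (up vs E)\<^sup>* \<or> (h, g) \<in> (up vs E)\<^sup>*"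
  using assms(2,3)
proof (induction arbitrary: h rule: converse_rtrancl_induct)
  case (step f f')
  from up_rtrancl_comparable_step[OF assms(1) step.prems step.hyps(1)]
  show ?case using step.IH step.hyps(2) by (meson rtrancl_trans)
qed auto

text \<open>All vertices of \<open>ws\<close> come after those of \<open>vs\<close>, so by
  domination every step of the walk passes the vertices in \<open>ws\<close> on to the next
  edge.\<close>

lemma up_outer_subset:
  assumes "xs = rev vs @ ws" "(f, g) \<in> (up vs E)\<^sup>*"
  shows "set f \<inter> set ws \<subseteq> set g"
  using assms(2)
proof (induction rule: converse_rtrancl_induct)
  case (step f f')
  obtain z where z: "z \<in> set f" "z \<in> set f'" "z \<in> set vs"
    using up_shares[OF step.hyps(1)] by (auto simp: shares_def)
  then obtain as bs where "rev vs = as @ z # bs" by (metis set_rev split_list)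
  then have "xs = as @ z # (bs @ ws)" using assms(1) by simp
  moreover have "dominated xs f f'" using step.hyps(1) sorted by (rule up_sorted_wrt)
  ultimately have "set f \<inter> set (bs @ ws) \<subseteq> set f'" using z unfolding dominated_def by blast
  with step.IH show ?case by auto
qed simp

lemma wsum_roots:
  assumes xs: "xs = rev vs @ ws" and R: "set R \<subseteq> set E"
    and closed: "\<And>g. g \<in> set R \<Longrightarrow> set (component vs E g) \<subseteq> set R"
  shows "wsum vs (set R) A = (\<Prod>f\<in>set (roots vs E R). wsum vs (set (component vs E f)) A)"
proof -
  let ?C = "\<lambda>g. set (component vs E g)"
  have sub: "set vs \<subseteq> set xs" using xs by auto
  have C: "f \<in> ?C g \<longleftrightarrow> (f, g) \<in> (up vs E)\<^sup>*" if "g \<in> set R" for f g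
    using mem_component_iff that R by blast
  have root: "\<exists>g\<in>set (roots vs E R). f \<in> ?C g" if f: "f \<in> set R" for f
  proof -
    let ?S = "{g \<in> set R. f \<in> ?C g}"
    have "finite ?S" "f \<in> ?S" using f C by auto
    \<comment> \<open>Among the edges of \<open>R\<close> whose component contains \<open>f\<close>,
      take one with a largest component. If another edge of \<open>R\<close> had \<open>g\<close> in
      its component, that component would be strictly larger.\<close>
    then obtain g where g: "g \<in> ?S" and max: "\<And>h. h \<in> ?S \<Longrightarrow> card (?C h) \<le> card (?C g)"
      using Max_in[of "(\<lambda>g. card (?C g)) ` ?S"] Max_ge[of "(\<lambda>g. card (?C g)) ` ?S"] by fastforce
    have "h = g" if h: "h \<in> set R" "g \<in> ?C h" for h
    proof (rule ccontr)
      assume "h \<noteq> g"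
      have gh: "(g, h) \<in> (up vs E)\<^sup>*" using h C by blast
      have gR: "g \<in> set R" "f \<in> ?C g" using g by auto
      have "?C g \<subseteq> ?C h" using C[OF h(1)] C[OF gR(1)] gh by (meson rtrancl_trans subsetI)
      moreover have "h \<in> ?C h" "h \<notin> ?C g"
        using C h gR gh up_antisym[OF distinct_edges] \<open>h \<noteq> g\<close> by blast+
      ultimately have "card (?C g) < card (?C h)" by (intro psubset_card_mono) auto
      moreover have "h \<in> ?S" using h gR \<open>?C g \<subseteq> ?C h\<close> by blast
      ultimately show False using max by fastforce
    qed
    then show ?thesis using g by (auto simp: roots_def)
  qed
  have "set R = (\<Union>g\<in>set (roots vs E R). ?C g)"
    using root closed by (auto simp: roots_def)
  moreover have "wsum vs (\<Union>g\<in>set (roots vs E R). ?C g) A = (\<Prod>g\<in>set (roots vs E R). wsum vs (?C g) A)"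
  proof (rule wsum_UN)
    fix g h e f
    assume g: "g \<in> set (roots vs E R)" and h: "h \<in> set (roots vs E R)" and "g \<noteq> h"
      and e: "e \<in> ?C g" and f: "f \<in> ?C h"
    have gR: "g \<in> set R" and hR: "h \<in> set R" using g h by (auto simp: roots_def)
    have ne: "(g, h) \<notin> (up vs E)\<^sup>*" "(h, g) \<notin> (up vs E)\<^sup>*"
      using g h \<open>g \<noteq> h\<close> C gR hR by (auto simp: roots_def)
    have eg: "(e, g) \<in> (up vs E)\<^sup>*" and fh: "(f, h) \<in> (up vs E)\<^sup>*" using e f C gR hR by auto
    show "set e \<inter> set f \<inter> set vs = {}"
    proof (rule ccontr)
      \<comment> \<open>A common vertex makes \<open>e\<close> and \<open>f\<close> equal or joined
        by a step. Then one of them has walks to both roots, which are therefore comparable.\<close>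
      assume "set e \<inter> set f \<inter> set vs \<noteq> {}"
      then have "shares vs e f" by (auto simp: shares_def)
      moreover have "e \<in> set E" "f \<in> set E" using e f component_subset by blast+
      ultimately consider "e = f" | "(e, f) \<in> up vs E" | "(f, e) \<in> up vs E" using up_total by blast
      then show False
      proof cases
        case 1
        then show False using up_rtrancl_comparable[OF sub eg] fh ne by blast
      next
        case 2
        then have "(e, h) \<in> (up vs E)\<^sup>*" using fh by (rule converse_rtrancl_into_rtrancl)
        then show False using up_rtrancl_comparable[OF sub eg] ne by blast
      next
        case 3
        then have "(f, g) \<in> (up vs E)\<^sup>*" using eg by (rule converse_rtrancl_into_rtrancl)
        then show False using up_rtrancl_comparable[OF sub fh] ne by blast
      qed
    qed
  qed simp
  ultimately show ?thesis by simp
qed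

text \<open>Edges already hit twice drop out; what remains is closed under components because outside
  \<open>vs\<close> the edges of a component are contained in its root.\<close>

lemma wsum_prod_table:
  assumes xs: "xs = rev vs @ ws" and C: "set C \<subseteq> set E"
    and closed: "\<And>g. g \<in> set C \<Longrightarrow> set (component vs E g) \<subseteq> set C"
    and A: "set A \<inter> set vs = {}"
  shows "wsum vs (set C) A =
    (\<Prod>f\<in>set (roots vs E (filter (\<lambda>f. hits A f < 2) C)).
       wsum vs (set (component vs E f)) (filter (\<lambda>a. a \<in> set f) A))"
proof -
  let ?R = "filter (\<lambda>f. hits A f < 2) C"
  \<comment> \<open>A vertex of \<open>A\<close> in an edge belongs to \<open>ws\<close>, and there
    the edges of a component are contained in its root.\<close>
  have sub: "a \<in> set g" if "g \<in> set C" "f \<in> set (component vs E g)" "a \<in> set A" "a \<in> set f" for f g a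
  proof -
    have "(f, g) \<in> (up vs E)\<^sup>*" using that C mem_component_iff by blast
    moreover have "f \<in> set E" using that component_subset by blast
    then have "a \<in> set ws" using that A covered[of f] xs by auto
    ultimately show ?thesis using up_outer_subset[OF xs] that by blast
  qed
  have "wsum vs (set C) A = wsum vs (set ?R) A"
    using wsum_drop_satisfied[of vs "set C" A] by simp
  also have "\<dots> = (\<Prod>f\<in>set (roots vs E ?R). wsum vs (set (component vs E f)) A)"
  proof (rule wsum_roots[OF xs])
    show "set ?R \<subseteq> set E" using C by auto
    fix g assume g: "g \<in> set ?R"
    \<comment> \<open>If a root is hit fewer than twice, so is every edge of its component; hence
      dropping satisfied edges keeps the set closed.\<close>
    have "hits A f \<le> hits A g" if "f \<in> set (component vs E g)" for f
    proof -
      have "filter (\<lambda>a. a \<in> set f) A = filter (\<lambda>a. a \<in> set f) (filter (\<lambda>a. a \<in> set g) A)"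
        using sub[of g f] g that by (auto intro: filter_cong)
      then show ?thesis by (metis length_filter_le)
    qed
    with g closed show "set (component vs E g) \<subseteq> set ?R" by fastforce
  qed
  also have "\<dots> = (\<Prod>f\<in>set (roots vs E ?R).
       wsum vs (set (component vs E f)) (filter (\<lambda>a. a \<in> set f) A))"
  proof (intro prod.cong wsum_cong refl)
    fix f e assume "f \<in> set (roots vs E ?R)" and e: "e \<in> set (component vs E f)"
    then have "f \<in> set C" by (simp add: roots_def)
    then show "hits A e = hits (filter (\<lambda>a. a \<in> set f) A) e"
      using sub e by (auto intro!: arg_cong[where f = length] filter_cong)
  qed
  finally show ?thesis .
qed

lemma component_closed:
  assumes "e \<in> set E" "g \<in> set (component (x # vs) E e)"
  shows "set (component vs E g) \<subseteq> set (component (x # vs) E e)"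
proof
  fix f assume f: "f \<in> set (component vs E g)"
  have "g \<in> set E" using assms component_subset by blast
  then have "(f, g) \<in> (up (x # vs) E)\<^sup>*"
    using f mem_component_iff rtrancl_mono[OF up_mono[of vs "x # vs" E]] by auto
  with assms show "f \<in> set (component (x # vs) E e)"
    by (simp add: mem_component_iff)
qed

text \<open>With all vertices decided and fewer than two of them to count, \<open>e\<close> itself
  violates its condition. The table can therefore start with zeros.\<close>

lemma wsum_Nil_component:
  assumes "e \<in> set E" "length A < 2"
  shows "wsum [] (set (component [] E e)) A = 0"
proof -
  have "e \<in> set (component [] E e)" using assms by (simp add: mem_component_iff)
  moreover have "hits A e < 2" using assms(2) length_filter_le[of _ A] by (meson le_less_trans)
  ultimately show ?thesis by (auto simp: not_le intro!: bexI[of _ e])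
qed

end

section \<open>Sorting edges and vertices\<close>

text \<open>The condition on the next vertex of a \<beta>-elimination order when the vertices of
  \<open>W\<close> remain, with bounded quantifiers so that it can be evaluated directly.\<close>

definition nest_point :: "'v \<Rightarrow> 'v list \<Rightarrow> 'v list list \<Rightarrow> bool" where
  "nest_point z W E \<longleftrightarrow> (\<forall>e\<in>set E. \<forall>f\<in>set E. z \<in> set e \<and> z \<in> set f \<longrightarrow>
     (\<forall>y\<in>set W. y \<in> set e \<longrightarrow> y \<in> set f) \<or> (\<forall>y\<in>set W. y \<in> set f \<longrightarrow> y \<in> set e))"

definition eliminates :: "'v list \<Rightarrow> 'v list list \<Rightarrow> bool" where
  "eliminates xs E \<longleftrightarrow> (\<forall>us z ws. xs = us @ z # ws \<longrightarrow> nest_point z (z # ws) E)"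

text \<open>A radix sort: each pass is a stable partition by one vertex, so the last vertex is the
  most significant one.\<close>

definition sort_edges :: "'v list \<Rightarrow> 'v list list \<Rightarrow> 'v list list" where
  "sort_edges xs E = fold (\<lambda>x E. filter (\<lambda>e. x \<notin> set e) E @ filter (\<lambda>e. x \<in> set e) E) xs E"

lemma set_sort_edges [simp]: "set (sort_edges xs E) = set E"
proof (induction xs arbitrary: E)
  case (Cons x xs)
  have "sort_edges (x # xs) E = sort_edges xs (filter (\<lambda>e. x \<notin> set e) E @ filter (\<lambda>e. x \<in> set e) E)"
    by (simp add: sort_edges_def)
  with Cons show ?case by auto
qed (simp add: sort_edges_def)

lemma distinct_sort_edges: "distinct E \<Longrightarrow> distinct (sort_edges xs E)"
proof (induction xs arbitrary: E)
  case (Cons x xs)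
  have "sort_edges (x # xs) E = sort_edges xs (filter (\<lambda>e. x \<notin> set e) E @ filter (\<lambda>e. x \<in> set e) E)"
    by (simp add: sort_edges_def)
  moreover have "distinct (filter (\<lambda>e. x \<notin> set e) E @ filter (\<lambda>e. x \<in> set e) E)"
    using Cons.prems by auto
  ultimately show ?case using Cons.IH by simp
qed (simp add: sort_edges_def)

lemma sorted_sort_edges:
  assumes "eliminates xs E" "distinct xs"
  shows "sorted_wrt (dominated xs) (sort_edges xs E)"
proof -
  have "sorted_wrt (dominated us) (sort_edges us E)" if "xs = us @ ws" for us ws
    using that
  proof (induction us arbitrary: ws rule: rev_induct)
    case Nil
    show ?case by (rule sorted_wrt_mono_rel[of _ "\<lambda>_ _. True"])
      (auto simp: dominated_def sort_edges_def sorted_wrt_iff_nth_less)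
  next
    case (snoc x us)
    let ?F = "sort_edges us E"
    have IH: "sorted_wrt (dominated us) ?F" using snoc.IH[of "x # ws"] snoc.prems by simp
    have x: "x \<notin> set us" using snoc.prems assms(2) by simp
    \<comment> \<open>Both edges contain \<open>x\<close> or neither does, so appending
      \<open>x\<close> preserves domination.\<close>
    have same: "dominated (us @ [x]) e f" if "dominated us e f" "x \<in> set e \<longleftrightarrow> x \<in> set f" for e f
      unfolding dominated_def
    proof (intro allI impI)
      fix as z bs assume *: "us @ [x] = as @ z # bs" "z \<in> set e" "z \<in> set f"
      show "set e \<inter> set bs \<subseteq> set f"
      proof (cases bs rule: rev_cases)
        case (snoc bs' b)
        then have "us = as @ z # bs'" "b = x" using * by (auto simp flip: append_Cons append_assoc)
        then show ?thesis using that * snoc unfolding dominated_def by auto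
      qed simp
    qed
    \<comment> \<open>From a shared earlier vertex \<open>z\<close> on, the edges are nested;
      \<open>x\<close> lies only in \<open>f\<close>, so \<open>e\<close> is the smaller
      one.\<close>
    have new: "dominated (us @ [x]) e f" if "e \<in> set ?F" "f \<in> set ?F" "x \<notin> set e" "x \<in> set f" for e f
      unfolding dominated_def
    proof (intro allI impI)
      fix as z bs assume *: "us @ [x] = as @ z # bs" "z \<in> set e" "z \<in> set f"
      show "set e \<inter> set bs \<subseteq> set f"
      proof (cases bs rule: rev_cases)
        case (snoc bs' b)
        then have "us = as @ z # bs'" "b = x" using * by (auto simp flip: append_Cons append_assoc)
        then have "xs = as @ z # (bs' @ x # ws)" using snoc.prems \<open>xs = (us @ [x]) @ ws\<close> by simp
        then have "nest_point z (z # (bs' @ x # ws)) E" using assms(1) unfolding eliminates_def by blast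
        with that * have "\<forall>y\<in>set (z # (bs' @ x # ws)). y \<in> set e \<longrightarrow> y \<in> set f"
          unfolding nest_point_def by fastforce
        then show ?thesis using snoc \<open>b = x\<close> by auto
      qed simp
    qed
    have "sort_edges (us @ [x]) E = filter (\<lambda>e. x \<notin> set e) ?F @ filter (\<lambda>e. x \<in> set e) ?F"
      by (simp add: sort_edges_def)
    moreover have sub: "sorted_wrt (dominated (us @ [x])) (filter P ?F)"
      if "\<And>e f. P e \<Longrightarrow> P f \<Longrightarrow> x \<in> set e \<longleftrightarrow> x \<in> set f" for P
      by (rule sorted_wrt_mono_rel[OF _ sorted_wrt_filter[OF IH]]) (use same that in auto)
    ultimately show ?case
      using new sub[of "\<lambda>e. x \<in> set e"] sub[of "\<lambda>e. x \<notin> set e"] by (simp add: sorted_wrt_append)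
  qed
  from this[of xs "[]"] show ?thesis by simp
qed

section \<open>Computing an elimination order\<close>

definition elim_step :: "'v list list \<Rightarrow> 'v list \<times> 'v list \<Rightarrow> 'v list \<times> 'v list" where
  "elim_step E s = (case filter (\<lambda>z. nest_point z (fst s) E) (fst s) of
     [] \<Rightarrow> s
   | z # _ \<Rightarrow> (filter (\<lambda>y. y \<noteq> z) (fst s), z # snd s))"

text \<open>Greedy removal of nest points. The list folded over only counts the rounds; removed
  vertices are stacked, hence the final reversal.\<close>

definition elim_order :: "'v list list \<Rightarrow> 'v list \<Rightarrow> 'v list" where
  "elim_order E V = rev (snd (fold (\<lambda>_. elim_step E) V (V, [])))"

text \<open>Greedy removal cannot get stuck: the first vertex of a given elimination order that lies
  in \<open>W\<close> is a nest point, because no vertex of \<open>W\<close> precedes it and chains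
  survive restriction to fewer vertices.\<close>

lemma nest_point_exists:
  assumes "beta_elimination_order (set ` set E) xs" "set W \<subseteq> vertices (set ` set E)" "W \<noteq> []"
  shows "\<exists>z\<in>set W. nest_point z W E"
proof -
  have "\<exists>x\<in>set xs. x \<in> set W"
    using assms by (cases W) (auto simp: beta_elimination_order_def)
  then obtain us z ws where xs: "xs = us @ z # ws" "z \<in> set W" "\<forall>u\<in>set us. u \<notin> set W"
    using split_list_first_prop[of xs "\<lambda>x. x \<in> set W"] by blast
  have W: "set W \<subseteq> set (z # ws)"
    using assms xs by (auto simp: beta_elimination_order_def)
  have "nest_point z W E"
    unfolding nest_point_def
  proof (intro ballI impI)
    fix e f assume ef: "e \<in> set E" "f \<in> set E" "z \<in> set e \<and> z \<in> set f"
    have i: "length us < length xs" "xs ! length us = z" "drop (length us) xs = z # ws"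
      using xs by auto
    have "\<forall>i<length xs. chain\<^sub>\<subseteq> {e \<inter> set (drop i xs) | e. e \<in> set ` set E \<and> xs ! i \<in> e}"
      using assms(1) unfolding beta_elimination_order_def by (elim conjE)
    from this[rule_format, OF i(1)]
    have chain: "chain\<^sub>\<subseteq> {e \<inter> set (z # ws) | e. e \<in> set ` set E \<and> z \<in> e}"
      unfolding i(2,3) .
    have "set g \<inter> set (z # ws) \<in> {e \<inter> set (z # ws) | e. e \<in> set ` set E \<and> z \<in> e}"
      if "g \<in> set E" "z \<in> set g" for g
      using that by blast
    note mem = this
    have "set e \<inter> set (z # ws) \<subseteq> set f \<inter> set (z # ws) \<or> set f \<inter> set (z # ws) \<subseteq> set e \<inter> set (z # ws)"
      using chain[unfolded chain_subset_def, THEN bspec, OF mem, THEN bspec, OF _ _ mem] ef by blast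
    with W show "(\<forall>y\<in>set W. y \<in> set e \<longrightarrow> y \<in> set f) \<or> (\<forall>y\<in>set W. y \<in> set f \<longrightarrow> y \<in> set e)"
      by blast
  qed
  with xs show ?thesis by blast
qed

lemma nest_point_cong: "set W = set W' \<Longrightarrow> nest_point z W E = nest_point z W' E"
  by (simp add: nest_point_def)

lemma elim_order:
  assumes beta: "beta_acyclic (set ` set E)" and V: "distinct V" "set V = vertices (set ` set E)"
  shows "distinct (elim_order E V)" "set (elim_order E V) = set V" "eliminates (elim_order E V) E"
proof -
  obtain xs where xs: "beta_elimination_order (set ` set E) xs"
    using beta by (auto simp: beta_acyclic_def)
  \<comment> \<open>\<open>zs\<close> lists the removed vertices, latest first. When
    \<open>z\<close> was chosen, the vertices left were \<open>z\<close>, those of \<open>as\<close>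
    and those of \<open>W\<close>; \<open>U\<close> ranges over all listings of this set.\<close>
  define Inv where "Inv W zs \<longleftrightarrow> distinct W \<and> distinct zs \<and> set W \<inter> set zs = {} \<and> set W \<union> set zs = set V
    \<and> (\<forall>as z bs. zs = as @ z # bs \<longrightarrow> (\<forall>U. set U = set W \<union> insert z (set as) \<longrightarrow> nest_point z U E))" for W zs
  have main: "Inv [] (snd (fold (\<lambda>_. elim_step E) us (W, zs)))"
    if "Inv W zs" "length us = length W" for us :: "'a list" and W zs
    using that
  proof (induction us arbitrary: W zs)
    case Nil
    then show ?case by simp
  next
    case (Cons u us)
    have "set W \<subseteq> vertices (set ` set E)" "W \<noteq> []" using Cons.prems V by (auto simp: Inv_def)
    from nest_point_exists[OF xs this]
    have "filter (\<lambda>z. nest_point z W E) W \<noteq> []" by (simp add: filter_empty_conv)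
    then obtain z rest where z: "filter (\<lambda>z. nest_point z W E) W = z # rest"
      by (meson neq_Nil_conv)
    then have "z \<in> set (filter (\<lambda>z. nest_point z W E) W)" by simp
    then have zW: "z \<in> set W" "nest_point z W E" by auto
    let ?W = "filter (\<lambda>y. y \<noteq> z) W"
    have step: "elim_step E (W, zs) = (?W, z # zs)" by (simp add: elim_step_def z)
    have len: "length ?W = length us"
    proof -
      have "card (set ?W) = card (set W - {z})" by (rule arg_cong[where f = card]) auto
      then show ?thesis using Cons.prems zW by (simp add: Inv_def flip: distinct_card)
    qed
    have old: "nest_point z' U E" if "zs = as @ z' # bs" "set U = set W \<union> insert z' (set as)" for as z' bs U
    proof -
      have "\<forall>as z bs. zs = as @ z # bs \<longrightarrow> (\<forall>U. set U = set W \<union> insert z (set as) \<longrightarrow> nest_point z U E)"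
        using Cons.prems(1) unfolding Inv_def by (elim conjE)
      with that show ?thesis by blast
    qed
    have "Inv ?W (z # zs)"
      unfolding Inv_def
    proof (intro conjI allI impI)
      fix as z' bs U assume *: "z # zs = as @ z' # bs" "set U = set ?W \<union> insert z' (set as)"
      show "nest_point z' U E"
      proof (cases as)
        case Nil
        then have "set U = set W" "z' = z" using * zW by auto
        then show ?thesis using zW(2) nest_point_cong[of U W z E] by simp
      next
        case (Cons a as')
        then have "zs = as' @ z' # bs" "set U = set W \<union> insert z' (set as')" using * zW by auto
        then show ?thesis by (rule old)
      qed
    qed (use Cons.prems zW in \<open>auto simp: Inv_def\<close>)
    moreover have "fold (\<lambda>_. elim_step E) (u # us) (W, zs) = fold (\<lambda>_. elim_step E) us (?W, z # zs)"
      by (simp add: step)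
    ultimately show ?case using Cons.IH[OF _ len[symmetric]] by metis
  qed
  have "Inv V []" using V by (simp add: Inv_def)
  from main[OF this refl]
  obtain zs where zs: "Inv [] zs" "elim_order E V = rev zs"
    unfolding elim_order_def by metis
  show "distinct (elim_order E V)" "set (elim_order E V) = set V"
    using zs by (auto simp: Inv_def)
  show "eliminates (elim_order E V) E"
    unfolding eliminates_def
  proof (intro allI impI)
    fix us z ws assume "elim_order E V = us @ z # ws"
    then have "zs = rev ws @ z # rev us" using zs(2) by (simp add: rev_swap)
    moreover have "\<forall>as z bs. zs = as @ z # bs \<longrightarrow> (\<forall>U. set U = set [] \<union> insert z (set as) \<longrightarrow> nest_point z U E)"
      using zs(1) unfolding Inv_def by (elim conjE)
    moreover have "set (z # ws) = set [] \<union> insert z (set (rev ws))" by simp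
    ultimately show "nest_point z (z # ws) E" by blast
  qed
qed

section \<open>The algorithm\<close>

definition lookup :: "('k \<times> nat) list \<Rightarrow> 'k \<Rightarrow> nat" where
  "lookup tab k = (case filter (\<lambda>p. fst p = k) tab of [] \<Rightarrow> 0 | p # ps \<Rightarrow> snd p)"

text \<open>The product formula of \<open>wsum_prod_table\<close> modulo
  \<open>2 ^ length us\<close>. The test on \<open>tl\<close> says that \<open>A\<close> hits the
  edge fewer than two times.\<close>

definition table_prod ::
  "'u list \<Rightarrow> 'v list \<Rightarrow> 'v list list \<Rightarrow> (('v list \<times> 'v list) \<times> nat) list \<Rightarrow> 'v list list \<Rightarrow> 'v list \<Rightarrow> nat" where
  "table_prod us vs E tab C A =
     fold (\<lambda>f p. mult_mod us p (lookup tab (f, filter (\<lambda>a. a \<in> set f) A)))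
       (roots vs E (filter (\<lambda>f. tl (filter (\<lambda>a. a \<in> set f) A) = []) C)) 1"

text \<open>The recursion of \<open>wsum\<close> for \<open>x # vs\<close>, with \<open>tab\<close>
  holding the values for \<open>vs\<close> and subtraction replaced by multiplication with
  -1.\<close>

definition table_entry ::
  "'u list \<Rightarrow> 'v list list \<Rightarrow> 'v \<Rightarrow> 'v list \<Rightarrow> (('v list \<times> 'v list) \<times> nat) list \<Rightarrow> 'v list \<times> 'v list \<Rightarrow> nat" where
  "table_entry us E x vs tab k = (let C = component (x # vs) E (fst k); A = snd k in
     add_mod us (table_prod us vs E tab C A)
       (add_mod us (mult_mod us (minus_one_mod us) (table_prod us vs E tab C (x # A)))
         (table_prod us vs E tab C (x # x # A))))"

definition table_step ::
  "'u list \<Rightarrow> 'v list list \<Rightarrow> ('v list \<times> 'v list) list \<Rightarrow> 'v \<Rightarrow>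
    'v list \<times> (('v list \<times> 'v list) \<times> nat) list \<Rightarrow> 'v list \<times> (('v list \<times> 'v list) \<times> nat) list" where
  "table_step us E ks x s = (x # fst s, map (\<lambda>k. (k, table_entry us E x (fst s) (snd s) k)) ks)"

text \<open>Edges that are hit twice drop out, so the weights on an edge that matter amount to at
  most one vertex of weight 1.\<close>

definition table_keys :: "'v list list \<Rightarrow> 'v list \<Rightarrow> ('v list \<times> 'v list) list" where
  "table_keys E V = concat (map (\<lambda>e. (e, []) # map (\<lambda>y. (e, [y])) V) E)"

definition table_count :: "'u list \<Rightarrow> 'v list \<Rightarrow> 'v list list \<Rightarrow> nat" where
  "table_count us xs E = (let s = fold (table_step us E (table_keys E xs)) xs
       ([], map (\<lambda>k. (k, 0)) (table_keys E xs))
     in table_prod us (fst s) E (snd s) E [])"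

text \<open>At most \<open>2 ^ length xs\<close> sets are counted, so the residue modulo
  \<open>2 ^ (length xs + 1)\<close> is the exact number. The list \<open>0 # xs\<close> supplies
  this exponent in unary.\<close>

definition count_minimal_transversals :: "nat list list \<Rightarrow> nat" where
  "count_minimal_transversals es = (let xs = elim_order es (remdups (concat es)) in
     table_count (0 # xs) xs (sort_edges xs es))"

subsection \<open>Correctness\<close>

lemma lookup_map: "k \<in> set ks \<Longrightarrow> lookup (map (\<lambda>k. (k, h k)) ks) k = h k"
  unfolding lookup_def by (induction ks) auto

lemma tl_eq_Nil_iff: "tl xs = [] \<longleftrightarrow> length xs < 2"
  by (cases xs) auto

lemma fold_mult_mod:
  "fold (\<lambda>f p. mult_mod us p (g f)) fs p mod 2 ^ length us = (p * (\<Prod>f\<leftarrow>fs. g f)) mod 2 ^ length us"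
proof (induction fs arbitrary: p)
  case (Cons f fs)
  have "(p * g f) mod 2 ^ length us * (\<Prod>f\<leftarrow>fs. g f) mod 2 ^ length us
    = (p * g f) * (\<Prod>f\<leftarrow>fs. g f) mod 2 ^ length us"
    by (rule mod_mult_left_eq)
  then show ?case using Cons.IH[of "mult_mod us p (g f)"] by (simp add: mult_mod_eq mult.assoc)
qed simp

lemma fold_mult_mod_less: "p < 2 ^ length us \<Longrightarrow> fold (\<lambda>f p. mult_mod us p (g f)) fs p < 2 ^ length us"
  by (induction fs arbitrary: p) (auto simp: mult_mod_eq)

context sorted_edges
begin

text \<open>A congruence, since \<open>wsum\<close> may be negative while the table holds natural
  numbers. The conditions on \<open>A\<close> describe the keys that the product formula asks
  for.\<close>

definition table_ok :: "'u list \<Rightarrow> 'v list \<Rightarrow> (('v list \<times> 'v list) \<times> nat) list \<Rightarrow> bool" where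
  "table_ok us vs tab \<longleftrightarrow> (\<forall>e A. e \<in> set E \<longrightarrow> set A \<subseteq> set e \<longrightarrow> set A \<inter> set vs = {} \<longrightarrow> length A < 2 \<longrightarrow>
     int (lookup tab (e, A)) mod 2 ^ length us = wsum vs (set (component vs E e)) A mod 2 ^ length us)"

lemma table_prod_correct:
  assumes tab: "table_ok us vs tab" and xs: "xs = rev vs @ ws"
    and C: "set C \<subseteq> set E" "distinct C" "\<And>g. g \<in> set C \<Longrightarrow> set (component vs E g) \<subseteq> set C"
    and A: "set A \<inter> set vs = {}"
  shows "int (table_prod us vs E tab C A) mod 2 ^ length us = wsum vs (set C) A mod 2 ^ length us"
proof -
  let ?M = "2 ^ length us"
  let ?A = "\<lambda>f. filter (\<lambda>a. a \<in> set f) A"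
  let ?R = "roots vs E (filter (\<lambda>f. hits A f < 2) C)"
  have "distinct ?R" using C(2) by (simp add: roots_def)
  then have "table_prod us vs E tab C A mod ?M = (\<Prod>f\<in>set ?R. lookup tab (f, ?A f)) mod ?M"
    using fold_mult_mod[of us _ ?R 1]
    by (simp add: table_prod_def tl_eq_Nil_iff prod.distinct_set_conv_list)
  then have "int (table_prod us vs E tab C A) mod ?M = int (\<Prod>f\<in>set ?R. lookup tab (f, ?A f)) mod ?M"
    by (auto dest!: arg_cong[where f = int] simp: of_nat_mod)
  also have "\<dots> = (\<Prod>f\<in>set ?R. int (lookup tab (f, ?A f)) mod ?M) mod ?M"
    by (simp add: mod_prod_eq)
  also have "\<dots> = (\<Prod>f\<in>set ?R. wsum vs (set (component vs E f)) (?A f) mod ?M) mod ?M"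
  proof -
    have "int (lookup tab (f, ?A f)) mod ?M = wsum vs (set (component vs E f)) (?A f) mod ?M"
      if "f \<in> set ?R" for f
    proof -
      have "f \<in> set E" "hits A f < 2" using C that by (auto simp: roots_def)
      then show ?thesis using A by (intro tab[unfolded table_ok_def, rule_format]) auto
    qed
    then show ?thesis by (simp cong: prod.cong)
  qed
  also have "\<dots> = wsum vs (set C) A mod ?M"
    using wsum_prod_table[OF xs C(1,3) A] by (simp add: mod_prod_eq)
  finally show ?thesis .
qed

lemma table_ok_step:
  assumes tab: "table_ok us vs tab" and xs: "xs = rev (x # vs) @ ws"
  shows "table_ok us (x # vs) (snd (table_step us E (table_keys E xs) x (vs, tab)))"
  unfolding table_ok_def
proof (intro allI impI)
  fix e A assume e: "e \<in> set E" and A: "set A \<subseteq> set e" "set A \<inter> set (x # vs) = {}" "length A < 2"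
  let ?M = "2 ^ length us :: int"
  let ?C = "component (x # vs) E e"
  let ?p = "table_prod us vs E tab ?C"
  have prod: "int (?p B) mod ?M = wsum vs (set ?C) B mod ?M" if "set B \<inter> set vs = {}" for B
    by (rule table_prod_correct[OF tab _ component_subset distinct_component[OF distinct_edges] _ that])
      (use xs component_closed[OF e] in auto)
  have x: "x \<notin> set vs" using distinct_vertices xs by auto
  have "(e, A) \<in> set (table_keys E xs)"
  proof (cases A)
    case (Cons y ys)
    then have "A = [y]" "y \<in> set xs" using A covered[OF e] by auto
    then show ?thesis using e by (auto simp: table_keys_def)
  qed (use e in \<open>auto simp: table_keys_def\<close>)
  then have "lookup (snd (table_step us E (table_keys E xs) x (vs, tab))) (e, A) = table_entry us E x vs tab (e, A)"
    by (simp add: table_step_def lookup_map)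
  also have "int \<dots> mod ?M = (int (?p A) + (int (minus_one_mod us) * int (?p (x # A)) + int (?p (x # x # A)))) mod ?M"
    by (simp add: table_entry_def Let_def add_mod_eq mult_mod_eq of_nat_mod mod_simps)
  also have "int (minus_one_mod us) = ?M - 1"
    using arg_cong[OF minus_one_mod_eq[of us], of int] by simp
  \<comment> \<open>Multiplying by \<open>?M - 1\<close> differs from changing the sign by a
    multiple of the modulus.\<close>
  also have "(int (?p A) + ((?M - 1) * int (?p (x # A)) + int (?p (x # x # A)))) mod ?M
    = (int (?p A) - int (?p (x # A)) + int (?p (x # x # A)) + int (?p (x # A)) * ?M) mod ?M"
    by (rule arg_cong[where f = "\<lambda>z. z mod ?M"]) (simp add: algebra_simps)
  also have "\<dots> = (int (?p A) - int (?p (x # A)) + int (?p (x # x # A))) mod ?M"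
    by simp
  also have "\<dots> = wsum (x # vs) (set ?C) A mod ?M"
    unfolding wsum.simps using A x by (intro mod_add_cong mod_diff_cong prod) auto
  finally show "int (lookup (snd (table_step us E (table_keys E xs) x (vs, tab))) (e, A)) mod ?M
    = wsum (x # vs) (set ?C) A mod ?M" .
qed

lemma table_ok_fold:
  assumes "xs = ys @ ws"
  shows "\<exists>tab. fold (table_step us E (table_keys E xs)) ys ([], map (\<lambda>k. (k, 0)) (table_keys E xs)) = (rev ys, tab)
    \<and> table_ok us (rev ys) tab"
  using assms
proof (induction ys arbitrary: ws rule: rev_induct)
  case Nil
  have "lookup (map (\<lambda>k. (k, 0)) ks) k = 0" for ks :: "('v list \<times> 'v list) list" and k
    unfolding lookup_def by (induction ks) auto
  then show ?case using wsum_Nil_component by (simp add: table_ok_def)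
next
  case (snoc x ys)
  let ?f = "table_step us E (table_keys E xs)"
  obtain tab where tab: "fold ?f ys ([], map (\<lambda>k. (k, 0)) (table_keys E xs)) = (rev ys, tab)"
    "table_ok us (rev ys) tab"
    using snoc.IH[of "x # ws"] snoc.prems by auto
  have "table_ok us (rev (ys @ [x])) (snd (?f x (rev ys, tab)))"
    using table_ok_step[OF tab(2), of x ws] snoc.prems by simp
  moreover have "?f x (rev ys, tab) = (rev (ys @ [x]), snd (?f x (rev ys, tab)))"
    by (simp add: table_step_def)
  ultimately show ?case using tab(1) by auto
qed

lemma table_count_correct:
  assumes "length us = Suc (length xs)" "set xs = vertices (set ` set E)"
  shows "table_count us xs E = card {T. minimal_transversal (set ` set E) T}"
proof -
  let ?n = "card {T. minimal_transversal (set ` set E) T}"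
  obtain tab where s: "fold (table_step us E (table_keys E xs)) xs ([], map (\<lambda>k. (k, 0)) (table_keys E xs))
    = (rev xs, tab)" and tab: "table_ok us (rev xs) tab"
    using table_ok_fold[of xs "[]" us] by auto
  have eq: "table_count us xs E = table_prod us (rev xs) E tab E []"
    by (simp add: table_count_def s)
  have "int (table_count us xs E) mod 2 ^ length us = wsum (rev xs) (set E) [] mod 2 ^ length us"
    unfolding eq by (rule table_prod_correct[OF tab, where ws = "[]"])
      (use component_subset distinct_edges in auto)
  also have "wsum (rev xs) (set E) [] = int ?n"
    using assms distinct_vertices by (intro wsum_eq_card) auto
  finally have "int (table_count us xs E mod 2 ^ length us) = int (?n mod 2 ^ length us)"
    by (simp add: of_nat_mod)
  then have "table_count us xs E mod 2 ^ length us = ?n mod 2 ^ length us"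
    by (simp only: of_nat_eq_iff)
  moreover have "table_count us xs E < 2 ^ length us"
    unfolding eq table_prod_def
    by (intro fold_mult_mod_less one_less_power) (simp_all add: assms(1))
  moreover have "?n < 2 ^ length us"
  proof -
    have "{T. minimal_transversal (set ` set E) T} \<subseteq> Pow (set xs)"
      using assms(2) by (auto simp: minimal_transversal_def transversal_def)
    then have "?n \<le> card (Pow (set xs))" by (intro card_mono) auto
    also have "\<dots> = 2 ^ length xs" using distinct_vertices by (simp add: card_Pow distinct_card)
    also have "\<dots> < 2 ^ length us" by (simp add: assms(1))
    finally show ?thesis .
  qed
  ultimately show ?thesis by simp
qed

end

lemma count_minimal_transversals_correct:
  assumes "beta_acyclic (set ` set es)" "distinct es"
  shows "count_minimal_transversals es = card {T. minimal_transversal (set ` set es) T}"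
proof -
  let ?V = "remdups (concat es)"
  let ?xs = "elim_order es ?V"
  have V: "distinct ?V" "set ?V = vertices (set ` set es)" by (auto simp: vertices_def)
  note xs = elim_order[OF assms(1) V]
  interpret sorted_edges ?xs "sort_edges ?xs es"
    using xs V sorted_sort_edges[OF xs(3,1)] distinct_sort_edges[OF assms(2)]
    by unfold_locales (auto simp: vertices_def)
  have "table_count (0 # ?xs) ?xs (sort_edges ?xs es)
    = card {T. minimal_transversal (set ` set (sort_edges ?xs es)) T}"
    using xs V by (intro table_count_correct) auto
  then show ?thesis by (simp add: count_minimal_transversals_def Let_def)
qed

subsection \<open>Running time\<close>

lemma polytime_shares [polytime_intros]:
  assumes "polytime vs" "polytime e" "polytime f"
  shows "polytime (\<lambda>x. shares (vs x :: nat list) (e x) (f x))"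
  unfolding shares_def by (intro polytime_intros assms[THEN polytime_compose])

lemma polytime_component [polytime_intros]:
  assumes "polytime vs" "polytime E" "polytime e"
  shows "polytime (\<lambda>x. component (vs x :: nat list) (E x) (e x))"
  unfolding component_def
  by (rule polytime_foldr_growth[where r = "\<lambda>x. Suc (esize (E x))"])
    (intro polytime_intros assms[THEN polytime_compose] pbound_Suc polytime_pbound |
      auto dest: esize_le_of_mem)+

lemma polytime_roots [polytime_intros]:
  assumes "polytime vs" "polytime E" "polytime R"
  shows "polytime (\<lambda>x. roots (vs x :: nat list) (E x) (R x))"
  unfolding roots_def by (intro polytime_intros assms[THEN polytime_compose])

lemma polytime_nest_point [polytime_intros]:
  assumes "polytime z" "polytime W" "polytime E"
  shows "polytime (\<lambda>x. nest_point (z x :: nat) (W x) (E x))"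
  unfolding nest_point_def by (intro polytime_intros assms[THEN polytime_compose])

lemma esize_filter_partition:
  "esize (filter P xs) + esize (filter (\<lambda>x. \<not> P x) xs) = esize xs"
  by (induction xs) auto

text \<open>Each pass permutes the list of edges, so the accumulator does not grow.\<close>

lemma polytime_sort_edges [polytime_intros]:
  assumes "polytime xs" "polytime E"
  shows "polytime (\<lambda>x. sort_edges (xs x :: nat list) (E x))"
  unfolding sort_edges_def
proof (rule polytime_fold_growth[where r = "\<lambda>_. 0"])
  show "esize (filter (\<lambda>e. y \<notin> set e) acc @ filter (\<lambda>e. y \<in> set e) acc) \<le> esize acc + 0" for y and acc :: "nat list list"
    using esize_filter_partition[of "\<lambda>e. y \<in> set e" acc] by (simp add: esize_append)
qed (intro polytime_intros pbound_const assms[THEN polytime_compose])+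

lemma esize_filter_neq: "z \<in> set W \<Longrightarrow> esize (filter (\<lambda>y. y \<noteq> z) W) + Suc (esize z) \<le> esize W"
proof (induction W)
  case (Cons w W)
  then show ?case using esize_filter[of "\<lambda>y. y \<noteq> z" W] by (cases "z \<in> set W") auto
qed simp

text \<open>The chosen vertex moves from the first list to the second, and the first loses at least
  the cells that the second gains.\<close>

lemma esize_elim_step: "esize (elim_step E s) \<le> esize s"
proof (cases "filter (\<lambda>z. nest_point z (fst s) E) (fst s)")
  case (Cons z zs)
  then have "z \<in> set (filter (\<lambda>z. nest_point z (fst s) E) (fst s))" by simp
  then have "z \<in> set (fst s)" by simp
  from esize_filter_neq[OF this] Cons show ?thesis by (simp add: elim_step_def enc_prod_def)
qed (simp add: elim_step_def)

lemma polytime_elim_step [polytime_intros]: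
  assumes "polytime E" "polytime s"
  shows "polytime (\<lambda>x. elim_step (E x :: nat list list) (s x))"
  unfolding elim_step_def by (intro polytime_intros assms[THEN polytime_compose])

lemma polytime_elim_order [polytime_intros]:
  assumes "polytime E" "polytime V"
  shows "polytime (\<lambda>x. elim_order (E x :: nat list list) (V x))"
proof -
  have "polytime (\<lambda>x. fold (\<lambda>_. elim_step (E x)) (V x) (V x, []))"
    by (rule polytime_fold_growth[where r = "\<lambda>_. 0"])
      (intro polytime_intros assms[THEN polytime_compose] pbound_const | simp add: esize_elim_step)+
  then show ?thesis unfolding elim_order_def by (intro polytime_intros)
qed

lemma polytime_lookup [polytime_intros]:
  fixes tab :: "'x::encodable \<Rightarrow> ((nat list \<times> nat list) \<times> nat) list"
  assumes "polytime tab" "polytime k"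
  shows "polytime (\<lambda>x. lookup (tab x) (k x))"
  unfolding lookup_def by (intro polytime_intros assms[THEN polytime_compose])

lemma esize_mult_mod: "esize (mult_mod us m n) \<le> 2 * esize us"
  using esize_less_power[of "mult_mod us m n" "length us"] length_le_esize[of us]
  by (simp add: mult_mod_eq)

lemma polytime_table_prod [polytime_intros]:
  fixes us :: "'x::encodable \<Rightarrow> 'u::encodable list" and vs :: "'x \<Rightarrow> nat list"
  assumes "polytime us" "polytime vs" "polytime E" "polytime tab" "polytime C" "polytime A"
  shows "polytime (\<lambda>x. table_prod (us x) (vs x) (E x) (tab x) (C x) (A x))"
  unfolding table_prod_def
proof (rule polytime_fold_growth[where r = "\<lambda>x. 2 * esize (us x)"])
  show "pbound (\<lambda>x. 2 * esize (us x))"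
    by (intro pbound_mult pbound_const polytime_pbound assms)
  show "esize (mult_mod (us x) acc n) \<le> esize acc + 2 * esize (us x)" for x acc n
    by (rule trans_le_add2) (rule esize_mult_mod)
qed (intro polytime_intros assms[THEN polytime_compose])+

lemma polytime_table_entry [polytime_intros]:
  fixes us :: "'x::encodable \<Rightarrow> 'u::encodable list" and vs :: "'x \<Rightarrow> nat list"
  assumes "polytime us" "polytime E" "polytime v" "polytime vs" "polytime tab" "polytime k"
  shows "polytime (\<lambda>x. table_entry (us x) (E x) (v x) (vs x) (tab x) (k x))"
  unfolding table_entry_def Let_def by (intro polytime_intros assms[THEN polytime_compose])

lemma polytime_table_keys [polytime_intros]:
  fixes V :: "'x::encodable \<Rightarrow> nat list"
  assumes "polytime E" "polytime V"
  shows "polytime (\<lambda>x. table_keys (E x) (V x))"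
  unfolding table_keys_def by (intro polytime_intros assms[THEN polytime_compose])

text \<open>All entries are residues, so the bound for the new table involves only the keys and the
  modulus, and sizes do not compound over the rounds.\<close>

lemma esize_table:
  "esize (map (\<lambda>k. (k, table_entry us E x vs tab k)) ks) \<le> esize ks * Suc (Suc (esize ks + 2 * esize us))"
proof -
  have "esize (map (\<lambda>k. (k, table_entry us E x vs tab k)) ks)
      \<le> length (map (\<lambda>k. (k, table_entry us E x vs tab k)) ks) * Suc (Suc (esize ks + 2 * esize us))"
  proof (rule esize_list_le)
    fix p assume "p \<in> set (map (\<lambda>k. (k, table_entry us E x vs tab k)) ks)"
    then obtain k where p: "p = (k, table_entry us E x vs tab k)" "k \<in> set ks" by auto
    have "esize (table_entry us E x vs tab k) \<le> 2 * length us"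
      by (rule esize_less_power) (simp add: table_entry_def Let_def add_mod_eq)
    then show "esize p \<le> Suc (esize ks + 2 * esize us)"
      using p esize_le_of_mem[OF p(2)] length_le_esize[of us] by simp
  qed
  also have "\<dots> \<le> esize ks * Suc (Suc (esize ks + 2 * esize us))"
    using length_le_esize[of ks] by (intro mult_right_mono) auto
  finally show ?thesis .
qed

lemma polytime_table_count [polytime_intros]:
  fixes us :: "'x::encodable \<Rightarrow> 'u::encodable list" and xs :: "'x \<Rightarrow> nat list"
  assumes us: "polytime us" and xs: "polytime xs" and E: "polytime E"
  shows "polytime (\<lambda>x. table_count (us x) (xs x) (E x))"
proof -
  let ?ks = "\<lambda>x. table_keys (E x) (xs x)"
  \<comment> \<open>The first summand pays for the vertex added to the processed list, the second
    for the whole new table.\<close>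
  let ?r = "\<lambda>x. Suc (esize (xs x)) + esize (?ks x) * Suc (Suc (esize (?ks x) + 2 * esize (us x)))"
  have "polytime (\<lambda>x. fold (table_step (us x) (E x) (?ks x)) (xs x) ([], map (\<lambda>k. (k, 0)) (?ks x)))"
  proof (rule polytime_fold_growth[where r = ?r])
    show "pbound ?r"
      by (intro pbound_add pbound_mult pbound_Suc pbound_const polytime_pbound polytime_intros us xs E)
    fix x y and acc :: "nat list \<times> ((nat list \<times> nat list) \<times> nat) list"
    assume "y \<in> set (xs x)"
    then have "esize y \<le> esize (xs x)" by (rule esize_le_of_mem)
    with esize_table[of "us x" "E x" y "fst acc" "snd acc" "?ks x"]
    show "esize (table_step (us x) (E x) (?ks x) y acc) \<le> esize acc + ?r x"
      by (simp add: table_step_def enc_prod_def)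
  qed (unfold table_step_def, (intro polytime_intros us[THEN polytime_compose] xs[THEN polytime_compose]
        E[THEN polytime_compose])+)
  then show ?thesis
    unfolding table_count_def Let_def by (intro polytime_intros assms)
qed

lemma polytime_remdups [polytime_intros]:
  assumes "polytime xs"
  shows "polytime (\<lambda>x. remdups (xs x :: nat list))"
proof -
  have "polytime (\<lambda>x. foldr (\<lambda>y acc. if y \<in> set acc then acc else y # acc) (xs x) [])"
    by (rule polytime_foldr_growth[where r = "\<lambda>x. Suc (esize (xs x))"])
      (intro polytime_intros assms pbound_Suc polytime_pbound | auto dest: esize_le_of_mem)+
  moreover have "foldr (\<lambda>y acc. if y \<in> set acc then acc else y # acc) ys [] = remdups ys" for ys :: "nat list"
    by (induction ys) auto
  ultimately show ?thesis by simp
qed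

lemma polytime_count_minimal_transversals: "polytime count_minimal_transversals"
  unfolding count_minimal_transversals_def Let_def by (intro polytime_intros)

text \<open>Translates bounds in the size of the encoding into bounds in
  \<open>hypergraph_size\<close>. The factor 2 arises because a bit takes at most two cells.\<close>

lemma esize_hypergraph_le:
  assumes "lists_hypergraph ess H"
  shows "esize ess \<le> 2 * hypergraph_size H"
proof -
  have d: "distinct (map set ess)" "\<And>es. es \<in> set ess \<Longrightarrow> distinct es" and H: "H = set (map set ess)"
    using assms by (auto simp: lists_hypergraph_def)
  have es: "esize es \<le> 2 * (\<Sum>v\<in>set es. 1 + length (nat_bits v))" if "distinct es" for es
  proof -
    have "esize es = (\<Sum>v\<leftarrow>es. Suc (esize v))" by (rule esize_list)
    also have "\<dots> \<le> (\<Sum>v\<leftarrow>es. 2 * (1 + length (nat_bits v)))"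
      by (intro sum_list_mono) (simp add: esize_nat_le le_SucI)
    also have "\<dots> = 2 * (\<Sum>v\<in>set es. 1 + length (nat_bits v))"
      by (simp only: sum_list_const_mult sum.distinct_set_conv_list[OF that])
    finally show ?thesis .
  qed
  have "esize ess = (\<Sum>es\<leftarrow>ess. Suc (esize es))" by (rule esize_list)
  also have "\<dots> \<le> (\<Sum>es\<leftarrow>ess. 2 * (1 + (\<Sum>v\<in>set es. 1 + length (nat_bits v))))"
    using es d(2) by (intro sum_list_mono) fastforce
  also have "\<dots> = 2 * hypergraph_size H"
    unfolding hypergraph_size_def H sum.distinct_set_conv_list[OF d(1)]
    by (simp only: sum_list_const_mult map_map o_def)
  finally show ?thesis .
qed

theorem mainTheorem6:
  shows "\<exists>(P :: com) (q :: nat poly).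
    \<forall>(H :: nat set set) (ess :: nat list list).
      hypergraph H \<longrightarrow> beta_acyclic H \<longrightarrow> lists_hypergraph ess H \<longrightarrow>
      (\<exists>t \<le> poly q (hypergraph_size H).
         runs_to P (encode_hypergraph ess) t (encode_nat (card {T. minimal_transversal H T})))"
proof -
  obtain P T where T: "pbound T" and P: "runs P count_minimal_transversals T"
    using polytime_count_minimal_transversals by (rule polytimeE)
  from T obtain q :: "nat poly" where q: "\<And>es. T es \<le> poly q (esize es)"
    unfolding pbound_def by blast
  \<comment> \<open>Substituting \<open>2 * n\<close> for the argument absorbs the factor in
    \<open>esize_hypergraph_le\<close>.\<close>
  let ?q = "pcompose q [:0, 2:]"
  have "\<exists>t \<le> poly ?q (hypergraph_size H).
      runs_to P (encode_hypergraph ess) t (encode_nat (card {T. minimal_transversal H T}))"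
    if "beta_acyclic H" and ess: "lists_hypergraph ess H" for H and ess :: "nat list list"
  proof -
    have H: "H = set ` set ess" "distinct ess"
      using ess by (auto simp: lists_hypergraph_def distinct_map)
    have enc: "enc ess = encode_hypergraph ess"
      by (simp add: encode_hypergraph_def enc_list_def[abs_def] enc_nat_def[abs_def])
    have "initial_state (encode_hypergraph ess) 0 = enc ess"
      by (simp add: initial_state_def enc)
    with P obtain t s where ts: "exec P (initial_state (encode_hypergraph ess)) t s"
      "s 0 = enc (count_minimal_transversals ess)" "t \<le> T ess"
      by (rule runsE)
    have "t \<le> poly q (esize ess)" using ts(3) q le_trans by blast
    also have "\<dots> \<le> poly ?q (hypergraph_size H)"
      using poly_nat_mono[OF esize_hypergraph_le[OF ess], of q] by (simp add: poly_pcompose mult.commute)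
    finally have "t \<le> poly ?q (hypergraph_size H)" .
    moreover have "s 0 = encode_nat (card {T. minimal_transversal H T})"
      using ts(2) count_minimal_transversals_correct[of ess] that(1) H by (simp add: enc_nat_def)
    ultimately show ?thesis using ts(1) unfolding runs_to_def by blast
  qed
  then show ?thesis by blast
qed

end
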